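(* Let $h\in\Bbbk[x]$ be monic of degree $N\geq 2$ with zero coefficient of $x^{N-1}$, and suppose $\psi=\gcd(h,h')\neq 1$. Let $w\in A_h$, let $H\in A_h$ be a special polynomial, let $s(x)\in\Bbbk[x]$ with $\deg(s(x))<\deg(h(x))$, put $w^\ast:=w+\psi^{-1}H\in\mathcal B$, and let $D=ad_w+E_H+\Delta_{s(x)}=[w^\ast,-]+\Delta_{s(x)}\in\operatorname{Der}(A_h)$. Let $\rho=\sigma_{r(x)}\circ\tau_a\in\operatorname{Aut}(A_h)$. Then $\rho\in\operatorname{Aut}_D(A_h)$ if and only if $$\rho(w^\ast)-w^\ast\in R_S\quad\text{and}\quad d_S(\rho(w^\ast)-w^\ast)=a^{1-N}s(ax)-s(x).$$
   Context: $\Bbbk$ is an algebraically closed field of characteristic zero. $A_h=\Bbbk[x][t;d]$, $d=h(x)\partial_x$, is the associative unital $\Bbbk$-algebra generated by $x,t$ subject to $tx=xt+h(x)$. $\operatorname{Aut}(A_h)$ and $\operatorname{Der}(A_h)$ denote $\Bbbk$-algebra automorphisms and $\Bbbk$-derivations; for $\delta\in\operatorname{Der}(A_h)$, $\operatorname{Aut}_\delta(A_h)=\{\rho\in\operatorname{Aut}(A_h)\mid\rho\delta=\delta\rho\}$. $[a,b]=ab-ba$ and $ad_w=[w,-]$. $\Delta_{s(x)}$ is the derivation of $A_h$ with $\Delta_{s(x)}(x)=0$, $\Delta_{s(x)}(t)=s(x)$. The degree of the zero polynomial is $-\infty$. For $h$ monic of degree $N\ge1$ with zero coefficient of $x^{N-1}$,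 every automorphism of $A_h$ is uniquely of the form $\sigma_{r(x)}\circ\tau_a$ with $r(x)\in\Bbbk[x]$ and $a\in\Bbbk^\ast$ satisfying $h(ax)=a^Nh(x)$, where $\sigma_{r(x)}(x)=x$, $\sigma_{r(x)}(t)=t+r(x)$, $\tau_a(x)=ax$, $\tau_a(t)=a^{N-1}t$. Let $S=\{\psi^n\mid n\ge0\}$, an Ore set in $A_h$; $R_S=\Bbbk[x][S^{-1}]$, $d_S:R_S\to R_S$ the unique derivation extending $d$ (so $d_S(u)=h\,u'$), and $\mathcal B=A_h[S^{-1}]\cong R_S[t;d_S]$ (with $tu=ut+d_S(u)$ for $u\in R_S$), which contains $A_h$ and $R_S$. Each $\rho\in\operatorname{Aut}(A_h)$ sends $\psi$ to a nonzero scalar multiple of $\psi$ and hence extends uniquely to an automorphism of $\mathcal B$, also denoted $\rho$. Let $r$ be the number of distinct roots of $h$, so $\deg\psi=N-r$. A special polynomial is an element $H=h_nt^n+\dots+h_1t\in A_h$ with $n\ge1$, $h_i\in\Bbbk[x]$, $\deg(h_i)<N-r$ for all $i$ (the zero polynomial is special). For $H$ special, $E_H(f)=[\psi^{-1}H,f]$ (commutator in $\mathcal B$), which is a well-defined derivation of $A_h$. *)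

theory Defs
  imports
    "HOL-Computational_Algebra.Computational_Algebra"
    "HOL-Algebra.Ring"
    "HOL-Algebra.Bij"
begin

section \<open>Ore extensions \<open>R[t; d]\<close>\<close>

text \<open>
  The polynomial \<open>f\<close> stands for \<open>\<Sum>i. coeff f i * t ^ i\<close>, with the coefficients on the left.
  Left multiplication by \<open>t\<close> is dictated by the relation \<open>t a = a t + d a\<close>.
\<close>

definition ore_t_mult :: "('r \<Rightarrow> 'r) \<Rightarrow> 'r::comm_ring_1 poly \<Rightarrow> 'r poly" where
  "ore_t_mult d g = pCons 0 g + map_poly d g"

definition ore_mult :: "('r \<Rightarrow> 'r) \<Rightarrow> 'r::comm_ring_1 poly \<Rightarrow> 'r poly \<Rightarrow> 'r poly" where
  "ore_mult d f g = (\<Sum>i\<le>degree f. smult (coeff f i) ((ore_t_mult d ^^ i) g))"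

text \<open>A ring only if \<open>C\<close> is a subring closed under the derivation \<open>d\<close>; see \<open>ore_data\<close> below.\<close>

definition ore_extension :: "'r::comm_ring_1 set \<Rightarrow> ('r \<Rightarrow> 'r) \<Rightarrow> 'r poly ring" where
  "ore_extension C d =
     \<lparr>carrier = {f. \<forall>i. coeff f i \<in> C}, monoid.mult = ore_mult d, one = 1, zero = 0, add = (+)\<rparr>"

lemma ore_extension_simps [simp]:
  "carrier (ore_extension C d) = {f. \<forall>i. coeff f i \<in> C}"
  "f \<otimes>\<^bsub>ore_extension C d\<^esub> g = ore_mult d f g"
  "\<one>\<^bsub>ore_extension C d\<^esub> = 1"
  "\<zero>\<^bsub>ore_extension C d\<^esub> = 0"
  "f \<oplus>\<^bsub>ore_extension C d\<^esub> g = f + g"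
  by (simp_all add: ore_extension_def)

locale ore_data =
  fixes C :: "'r::comm_ring_1 set" and d :: "'r \<Rightarrow> 'r"
  assumes d_add: "d (a + b) = d a + d b"
    and d_mult: "d (a * b) = d a * b + a * d b"
    and C_1: "1 \<in> C"
    and C_diff: "a \<in> C \<Longrightarrow> b \<in> C \<Longrightarrow> a - b \<in> C"
    and C_mult: "a \<in> C \<Longrightarrow> b \<in> C \<Longrightarrow> a * b \<in> C"
    and C_d: "a \<in> C \<Longrightarrow> d a \<in> C"
begin

abbreviation "L \<equiv> ore_t_mult d"
abbreviation "M \<equiv> ore_mult d"

lemma d_0 [simp]: "d 0 = 0"
  using d_add[of 0 0] by simp

lemma d_1 [simp]: "d 1 = 0"
  using d_mult[of 1 1] by simp

lemma C_0 [simp]: "0 \<in> C"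
  using C_diff[OF C_1 C_1] by simp

lemma C_minus: "a \<in> C \<Longrightarrow> - a \<in> C"
  using C_diff[OF C_0] by force

lemma C_add: "a \<in> C \<Longrightarrow> b \<in> C \<Longrightarrow> a + b \<in> C"
  using C_diff[of a "- b"] C_minus[of b] by simp

lemma coeff_L: "coeff (L g) i = (case i of 0 \<Rightarrow> 0 | Suc j \<Rightarrow> coeff g j) + d (coeff g i)"
  by (simp add: ore_t_mult_def coeff_map_poly coeff_pCons)

lemma L_add: "L (f + g) = L f + L g"
  by (rule poly_eqI) (simp add: coeff_L d_add split: nat.split)

lemma L_0 [simp]: "L 0 = 0"
  by (simp add: ore_t_mult_def)

lemma L_smult: "L (smult a g) = smult a (L g) + smult (d a) g"
  by (rule poly_eqI) (simp add: coeff_L d_mult algebra_simps split: nat.split)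

lemma L_pow_add: "(L ^^ n) (f + g) = (L ^^ n) f + (L ^^ n) g"
  by (induction n) (simp_all add: L_add)

lemma M_eq:
  assumes "degree f \<le> n"
  shows "M f g = (\<Sum>i\<le>n. smult (coeff f i) ((L ^^ i) g))"
  unfolding ore_mult_def
  by (rule sum.mono_neutral_left) (use assms in \<open>auto simp: coeff_eq_0\<close>)

lemma M_add_left: "M (f + g) k = M f k + M g k"
  by (simp add: M_eq[of _ "max (degree f) (degree g)"] degree_add_le
      smult_add_left sum.distrib)

lemma M_smult: "M (smult a f) g = smult a (M f g)"
proof -
  have "degree (smult a f) \<le> degree f"
    by (rule degree_smult_le)
  from M_eq[OF this, of g] show ?thesis
    by (intro poly_eqI) (simp add: ore_mult_def coeff_sum sum_distrib_left mult.assoc)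
qed

lemma M_add_right: "M f (g + k) = M f g + M f k"
  by (simp add: ore_mult_def L_pow_add smult_add_right sum.distrib)

lemma M_0 [simp]: "M 0 g = 0"
  by (simp add: ore_mult_def)

lemma M_pCons: "M (pCons a f) g = smult a g + M f (L g)"
proof -
  have "M (pCons a f) g = (\<Sum>i\<le>Suc (degree f). smult (coeff (pCons a f) i) ((L ^^ i) g))"
    by (rule M_eq) (rule degree_pCons_le)
  then show ?thesis
    by (simp add: sum.atMost_Suc_shift ore_mult_def funpow_swap1 del: sum.atMost_Suc)
qed

lemma M_const: "M [:a:] g = smult a g"
  by (simp add: M_pCons)

lemma M_t: "M [:0, 1:] g = L g"
  by (simp add: M_pCons)

lemma L_pow_1: "(L ^^ n) 1 = monom 1 n"
proof (induction n)
  case (Suc n)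
  have "map_poly d (monom 1 n) = 0"
    by (simp add: map_poly_monom)
  with Suc show ?case
    by (simp add: ore_t_mult_def monom_Suc)
qed simp

lemma M_1_right: "M f 1 = f"
  by (simp add: ore_mult_def L_pow_1 smult_monom poly_as_sum_of_monoms)

lemma L_M: "L (M f g) = M (L f) g"
proof (induction f arbitrary: g)
  case (pCons a f)
  have *: "L (pCons a f) = pCons (d a) (L f) + pCons 0 [:a:]"
    by (rule poly_eqI) (simp add: coeff_L coeff_pCons split: nat.split)
  have "L (M (pCons a f) g) = smult a (L g) + smult (d a) g + M (L f) (L g)"
    by (simp add: M_pCons L_add L_smult pCons.IH)
  also have "\<dots> = M (L (pCons a f)) g"
    unfolding * by (simp add: M_add_left M_pCons)
  finally show ?case .
qed simp

lemma M_assoc: "M (M f g) k = M f (M g k)"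
  by (induction f arbitrary: g) (simp_all add: M_pCons M_add_left M_smult L_M)

lemma L_closed: "\<forall>i. coeff g i \<in> C \<Longrightarrow> \<forall>i. coeff (L g) i \<in> C"
  by (auto simp: coeff_L C_add C_d split: nat.split)

lemma M_closed: "\<forall>i. coeff f i \<in> C \<Longrightarrow> \<forall>i. coeff g i \<in> C \<Longrightarrow> \<forall>i. coeff (M f g) i \<in> C"
proof (induction f arbitrary: g)
  case (pCons a f)
  have a: "a \<in> C"
    using pCons.prems(1) by (metis coeff_pCons_0)
  have f: "\<forall>i. coeff f i \<in> C"
    using pCons.prems(1) by (metis coeff_pCons_Suc)
  have "\<forall>i. coeff (M f (L g)) i \<in> C"
    by (rule pCons.IH[OF f L_closed[OF pCons.prems(2)]])
  with a pCons.prems(2) show ?case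
    by (simp add: M_pCons C_add C_mult)
qed simp

lemma ring_ore_extension: "ring (ore_extension C d)"
proof (rule ringI)
  show "abelian_group (ore_extension C d)"
  proof (rule abelian_groupI)
    fix f assume "f \<in> carrier (ore_extension C d)"
    then show "\<exists>g\<in>carrier (ore_extension C d). g \<oplus>\<^bsub>ore_extension C d\<^esub> f = \<zero>\<^bsub>ore_extension C d\<^esub>"
      by (intro bexI[of _ "- f"]) (auto simp: C_minus)
  qed (auto simp: C_add algebra_simps)
  show "Group.monoid (ore_extension C d)"
  proof (rule monoidI)
    show "\<one>\<^bsub>ore_extension C d\<^esub> \<in> carrier (ore_extension C d)"
      by (auto simp: coeff_1 C_1)
    show "\<one>\<^bsub>ore_extension C d\<^esub> \<otimes>\<^bsub>ore_extension C d\<^esub> f = f" for f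
      using M_const[of 1 f] by (simp add: one_pCons)
  qed (use M_closed in \<open>auto simp: M_assoc M_1_right\<close>)
qed (simp_all add: M_add_left M_add_right)

end


section \<open>The algebra \<open>A_h = \<Bbbk>[x][t; h \<partial>_x]\<close>\<close>

definition alg_A :: "'a::field poly \<Rightarrow> 'a poly poly ring" where
  "alg_A h = ore_extension UNIV (\<lambda>p. h * pderiv p)"

definition gen_x :: "'a::field poly poly" where
  "gen_x = [:[:0, 1:]:]"

definition gen_t :: "'a::field poly poly" where
  "gen_t = [:0, 1:]"

lemma ore_data_A: "ore_data UNIV (\<lambda>p. h * pderiv p)"
  by unfold_locales (simp_all add: pderiv_add pderiv_mult algebra_simps)

lemma ring_alg_A: "ring (alg_A h)"
  unfolding alg_A_def by (rule ore_data.ring_ore_extension[OF ore_data_A])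

lemma gen_t_gen_x: "gen_t \<otimes>\<^bsub>alg_A h\<^esub> gen_x = gen_x \<otimes>\<^bsub>alg_A h\<^esub> gen_t + [:h:]"
proof -
  interpret ore_data UNIV "\<lambda>p. h * pderiv p"
    by (rule ore_data_A)
  show ?thesis
    by (simp add: alg_A_def gen_t_def gen_x_def M_const M_pCons ore_t_mult_def
        map_poly_pCons pderiv_pCons)
qed


section \<open>The localization \<open>B = A_h[S\<^sup>-\<^sup>1] = R_S[t; d_S]\<close>\<close>

definition psi :: "'a::field_gcd poly \<Rightarrow> 'a poly" where
  "psi h = gcd h (pderiv h)"

definition R_S :: "'a::field_gcd poly \<Rightarrow> 'a poly fract set" where
  "R_S h = {to_fract p / to_fract (psi h) ^ n | p n. True}"

definition fract_deriv :: "'a::field_gcd poly fract \<Rightarrow> 'a poly fract" where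
  "fract_deriv u =
     (case quot_of_fract u of (p, q) \<Rightarrow> Fract (pderiv p * q - p * pderiv q) (q * q))"

lemma fract_deriv_Fract:
  assumes "q \<noteq> 0"
  shows "fract_deriv (Fract p q) = Fract (pderiv p * q - p * pderiv q) (q * q)"
proof -
  obtain p' q' where pq': "quot_of_fract (Fract p q) = (p', q')"
    by fastforce
  have q': "q' \<noteq> 0"
    using snd_quot_of_fract_nonzero[of "Fract p q"] pq' by simp
  have "Fract p' q' = Fract p q"
    using Fract_quot_of_fract[of "Fract p q"] pq' by simp
  then have eq: "p' * q = p * q'"
    using assms q' by (simp add: eq_fract)
  have "pderiv p' * q + p' * pderiv q = pderiv p * q' + p * pderiv q'"
    using arg_cong[OF eq, of pderiv] by (simp add: pderiv_mult algebra_simps)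
  then have eq': "pderiv p' * q = pderiv p * q' + p * pderiv q' - p' * pderiv q"
    by (simp add: algebra_simps)
  have "(pderiv p' * q' - p' * pderiv q') * (q * q)
      = q * q' * (pderiv p' * q) - pderiv q' * q * (p' * q)"
    by (simp add: algebra_simps)
  also have "\<dots> = q' * q' * pderiv p * q - q' * pderiv q * (p' * q)"
    unfolding eq' eq by (simp add: algebra_simps eq)
  also have "\<dots> = (pderiv p * q - p * pderiv q) * (q' * q')"
    unfolding eq by (simp add: algebra_simps)
  finally have "(pderiv p' * q' - p' * pderiv q') * (q * q) = (pderiv p * q - p * pderiv q) * (q' * q')" .
  then show ?thesis
    using assms q' by (simp add: fract_deriv_def pq' eq_fract)
qed

definition d_S :: "'a::field_gcd poly \<Rightarrow> 'a poly fract \<Rightarrow> 'a poly fract" where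
  "d_S h u = to_fract h * fract_deriv u"

text \<open>
  \<open>R_S\<close> is a subring of the field \<open>\<Bbbk>(x)\<close>, and \<open>B\<close> is represented by its model \<open>R_S[t; d_S]\<close>:
  polynomials in \<open>t\<close> over \<open>\<Bbbk>(x)\<close> whose coefficients lie in \<open>R_S\<close>. Then \<open>R_S\<close> is embedded in
  \<open>B\<close> as the constant polynomials, and \<open>A_to_B\<close> is the inclusion of \<open>A_h\<close>.
\<close>

definition alg_B :: "'a::field_gcd poly \<Rightarrow> 'a poly fract poly ring" where
  "alg_B h = ore_extension (R_S h) (d_S h)"

definition A_to_B :: "'a::field poly poly \<Rightarrow> 'a poly fract poly" where
  "A_to_B f = map_poly to_fract f"

lemma fract_deriv_to_fract: "fract_deriv (to_fract p) = to_fract (pderiv p)"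
  by (simp add: to_fract_def fract_deriv_Fract)

lemma fract_deriv_add: "fract_deriv (u + v) = fract_deriv u + fract_deriv v"
proof -
  obtain p q where u: "u = Fract p q" "q \<noteq> 0" by (cases u) auto
  obtain p' q' where v: "v = Fract p' q'" "q' \<noteq> 0" by (cases v) auto
  show ?thesis
    using u v by (simp add: fract_deriv_Fract eq_fract pderiv_add pderiv_mult algebra_simps)
qed

lemma fract_deriv_mult: "fract_deriv (u * v) = fract_deriv u * v + u * fract_deriv v"
proof -
  obtain p q where u: "u = Fract p q" "q \<noteq> 0" by (cases u) auto
  obtain p' q' where v: "v = Fract p' q'" "q' \<noteq> 0" by (cases v) auto
  show ?thesis
    using u v by (simp add: fract_deriv_Fract eq_fract pderiv_mult algebra_simps)
qed

lemma d_S_to_fract: "d_S h (to_fract p) = to_fract (h * pderiv p)"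
  by (simp add: d_S_def fract_deriv_to_fract)

lemma R_S_I: "u = to_fract p / to_fract (psi h) ^ n \<Longrightarrow> u \<in> R_S h"
  by (auto simp: R_S_def)

lemma R_S_d_S:
  assumes "h \<noteq> 0" "u \<in> R_S h"
  shows "d_S h u \<in> R_S h"
proof -
  define P where "P = psi h"
  have P: "P \<noteq> 0"
    using assms(1) by (simp add: P_def psi_def)
  obtain p n where u: "u = to_fract p / to_fract P ^ n"
    using assms(2) by (auto simp: R_S_def P_def)
  have Pn: "to_fract (P ^ n) = to_fract P ^ n" for n
    by (induction n) simp_all
  have "u = Fract p (P ^ n)"
    using P by (simp only: u Pn[symmetric]) (simp add: to_fract_def)
  then have "fract_deriv u = Fract (pderiv p * P ^ n - p * pderiv (P ^ n)) (P ^ n * P ^ n)"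
    using P by (simp add: fract_deriv_Fract)
  also have "\<dots> = to_fract (pderiv p * P ^ n - p * pderiv (P ^ n)) / to_fract P ^ (n + n)"
    using P by (simp only: Pn[symmetric] power_add) (simp add: to_fract_def)
  finally show ?thesis
    unfolding d_S_def
    by (intro R_S_I[of _ "h * (pderiv p * P ^ n - p * pderiv (P ^ n))" h "n + n"]) (simp add: P_def)
qed

lemma ore_data_B:
  assumes "h \<noteq> 0"
  shows "ore_data (R_S h) (d_S h)"
proof
  define P where "P = psi h"
  have P: "to_fract P \<noteq> 0"
    using assms by (simp add: P_def psi_def)
  have Pn: "to_fract (P ^ n) = to_fract P ^ n" for n
    by (induction n) simp_all
  show "1 \<in> R_S h"
    by (rule R_S_I[of _ 1 h 0]) simp
  fix u v assume "u \<in> R_S h" "v \<in> R_S h"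
  then obtain p n q m
    where uv: "u = to_fract p / to_fract P ^ n" "v = to_fract q / to_fract P ^ m"
    by (auto simp: R_S_def P_def)
  show "u - v \<in> R_S h"
    by (rule R_S_I[of _ "p * P ^ m - q * P ^ n" h "n + m"])
      (use P in \<open>simp add: uv P_def[symmetric] Pn power_add field_simps\<close>)
  show "u * v \<in> R_S h"
    by (rule R_S_I[of _ "p * q" h "n + m"]) (simp add: uv P_def[symmetric] power_add)
qed (use assms in \<open>simp_all add: R_S_d_S, simp_all add: d_S_def fract_deriv_add fract_deriv_mult algebra_simps\<close>)

lemma ring_alg_B: "h \<noteq> 0 \<Longrightarrow> ring (alg_B h)"
  unfolding alg_B_def by (rule ore_data.ring_ore_extension[OF ore_data_B])


section \<open>Automorphisms and derivations\<close>

text \<open>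
  Automorphisms of a \<open>\<Bbbk>\<close>-algebra \<open>R\<close> with structure map \<open>\<kappa>\<close>. The set \<^const>\<open>Bij\<close> consists of
  \<^emph>\<open>extensional\<close> bijections, so that automorphisms are determined by their values on the carrier.
\<close>

definition alg_Aut :: "('a \<Rightarrow> 'b) \<Rightarrow> 'b ring \<Rightarrow> ('b \<Rightarrow> 'b) set" where
  "alg_Aut \<kappa> R = {\<phi> \<in> ring_hom R R \<inter> Bij (carrier R). \<forall>c. \<phi> (\<kappa> c) = \<kappa> c}"

definition Aut_A :: "'a::field poly \<Rightarrow> ('a poly poly \<Rightarrow> 'a poly poly) set" where
  "Aut_A h = alg_Aut (\<lambda>c. [:[:c:]:]) (alg_A h)"

definition Aut_B :: "'a::field_gcd poly \<Rightarrow> ('a poly fract poly \<Rightarrow> 'a poly fract poly) set" where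
  "Aut_B h = alg_Aut (\<lambda>c. [:to_fract [:c:]:]) (alg_B h)"

text \<open>
  Automorphisms of \<open>A_h\<close> send \<open>\<psi>\<close> to a nonzero scalar multiple of itself, so exactly one \<open>\<phi>\<close> qualifies.
\<close>

definition extend_B ::
    "'a::field_gcd poly \<Rightarrow> ('a poly poly \<Rightarrow> 'a poly poly) \<Rightarrow> 'a poly fract poly \<Rightarrow> 'a poly fract poly"
  where "extend_B h \<rho> = (THE \<phi>. \<phi> \<in> Aut_B h \<and> (\<forall>f. \<phi> (A_to_B f) = A_to_B (\<rho> f)))"

definition Der_A :: "'a::field poly \<Rightarrow> ('a poly poly \<Rightarrow> 'a poly poly) set" where
  "Der_A h = {\<delta>.
     (\<forall>f g. \<delta> (f + g) = \<delta> f + \<delta> g) \<and>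
     (\<forall>c f. \<delta> (smult [:c:] f) = smult [:c:] (\<delta> f)) \<and>
     (\<forall>f g. \<delta> (f \<otimes>\<^bsub>alg_A h\<^esub> g) = \<delta> f \<otimes>\<^bsub>alg_A h\<^esub> g + f \<otimes>\<^bsub>alg_A h\<^esub> \<delta> g)}"

definition Aut_commuting ::
    "'a::field poly \<Rightarrow> ('a poly poly \<Rightarrow> 'a poly poly) \<Rightarrow> ('a poly poly \<Rightarrow> 'a poly poly) set" where
  "Aut_commuting h \<delta> = {\<rho> \<in> Aut_A h. \<rho> \<circ> \<delta> = \<delta> \<circ> \<rho>}"

definition sigma :: "'a::field poly \<Rightarrow> 'a poly \<Rightarrow> 'a poly poly \<Rightarrow> 'a poly poly" where
  "sigma h r = (THE \<phi>. \<phi> \<in> Aut_A h \<and> \<phi> gen_x = gen_x \<and> \<phi> gen_t = gen_t + [:r:])"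

text \<open>Used only for \<open>a \<noteq> 0\<close> with \<open>h(ax) = a\<^sup>N h(x)\<close>, where \<open>N = degree h\<close>.\<close>

definition tau :: "'a::field poly \<Rightarrow> 'a \<Rightarrow> 'a poly poly \<Rightarrow> 'a poly poly" where
  "tau h a = (THE \<phi>. \<phi> \<in> Aut_A h \<and>
     \<phi> gen_x = smult [:a:] gen_x \<and> \<phi> gen_t = smult [:a ^ (degree h - 1):] gen_t)"

definition Delta :: "'a::field poly \<Rightarrow> 'a poly \<Rightarrow> 'a poly poly \<Rightarrow> 'a poly poly" where
  "Delta h s = (THE \<delta>. \<delta> \<in> Der_A h \<and> \<delta> gen_x = 0 \<and> \<delta> gen_t = [:s:])"

definition ad_A :: "'a::field poly \<Rightarrow> 'a poly poly \<Rightarrow> 'a poly poly \<Rightarrow> 'a poly poly" where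
  "ad_A h w f = w \<otimes>\<^bsub>alg_A h\<^esub> f - f \<otimes>\<^bsub>alg_A h\<^esub> w"

definition ad_B ::
    "'a::field_gcd poly \<Rightarrow> 'a poly fract poly \<Rightarrow> 'a poly fract poly \<Rightarrow> 'a poly fract poly" where
  "ad_B h w f = w \<otimes>\<^bsub>alg_B h\<^esub> f - f \<otimes>\<^bsub>alg_B h\<^esub> w"

text \<open>Special polynomials; the first disjunct expresses \<open>deg 0 = -\<infinity>\<close>.\<close>

definition special :: "'a::field poly \<Rightarrow> 'a poly poly \<Rightarrow> bool" where
  "special h H \<longleftrightarrow> coeff H 0 = 0 \<and>
     (\<forall>i. coeff H i = 0 \<or> degree (coeff H i) < degree h - card {x. poly h x = 0})"

definition psi_inv_mult :: "'a::field_gcd poly \<Rightarrow> 'a poly poly \<Rightarrow> 'a poly fract poly" where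
  "psi_inv_mult h H = [:inverse (to_fract (psi h)):] \<otimes>\<^bsub>alg_B h\<^esub> A_to_B H"

text \<open>For special \<open>H\<close>, the commutator with \<open>\<psi>\<^sup>-\<^sup>1 H\<close> in \<open>B\<close> maps \<open>A_h\<close> into itself.\<close>

definition E_der :: "'a::field_gcd poly \<Rightarrow> 'a poly poly \<Rightarrow> 'a poly poly \<Rightarrow> 'a poly poly" where
  "E_der h H f = (THE g. A_to_B g = ad_B h (psi_inv_mult h H) (A_to_B f))"

end

theory Submission
  imports Defs
begin

text \<open>
  Put \<open>z = \<rho>(w\<^sup>*) - w\<^sup>*\<close>. Since \<open>\<rho> [w\<^sup>*, f] = [\<rho>(w\<^sup>*), \<rho>(f)]\<close>, the automorphism \<open>\<rho>\<close> commutes with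
  \<open>D\<close> iff \<open>[z, \<rho>(f)] = \<Delta>(\<rho>(f)) - \<rho>(\<Delta>(f))\<close> for all \<open>f\<close>. Both sides are \<open>\<rho>\<close>-derivations in \<open>f\<close>, so it
  suffices to compare them at \<open>x\<close> and \<open>t\<close>. At \<open>x\<close> the identity says that \<open>z\<close> commutes with \<open>x\<close>,
  which in characteristic \<open>0\<close> means \<open>z \<in> R\<^sub>S\<close>; at \<open>t\<close> it is then the equation for \<open>d\<^sub>S(z)\<close>.
\<close>

section \<open>Additive maps out of an Ore extension, prescribed on powers of t\<close>

definition ore_lin :: "('r \<Rightarrow> 'r) \<Rightarrow> (nat \<Rightarrow> 'r poly) \<Rightarrow> 'r::comm_ring_1 poly \<Rightarrow> 'r poly" where
  "ore_lin \<theta> e f = (\<Sum>i\<le>degree f. smult (\<theta> (coeff f i)) (e i))"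

lemma ore_lin_eq:
  assumes "\<theta> 0 = 0" "degree f \<le> n"
  shows "ore_lin \<theta> e f = (\<Sum>i\<le>n. smult (\<theta> (coeff f i)) (e i))"
  unfolding ore_lin_def
  by (rule sum.mono_neutral_left) (use assms in \<open>auto simp: coeff_eq_0\<close>)

lemma ore_lin_0 [simp]: "\<theta> 0 = 0 \<Longrightarrow> ore_lin \<theta> e 0 = 0"
  by (simp add: ore_lin_def)

text \<open>Peeling off the constant coefficient shifts the family \<open>e\<close> by one, which is
  why inductions on \<open>f\<close> generalise over \<open>e\<close>.\<close>

lemma ore_lin_pCons:
  assumes "\<theta> 0 = 0"
  shows "ore_lin \<theta> e (pCons a f) = smult (\<theta> a) (e 0) + ore_lin \<theta> (\<lambda>i. e (Suc i)) f"
proof -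
  have "ore_lin \<theta> e (pCons a f) = (\<Sum>i\<le>Suc (degree f). smult (\<theta> (coeff (pCons a f) i)) (e i))"
    using assms degree_pCons_le by (rule ore_lin_eq)
  then show ?thesis
    by (simp add: sum.atMost_Suc_shift ore_lin_def del: sum.atMost_Suc)
qed

lemma ore_lin_add:
  assumes "\<theta> 0 = 0" "\<And>p q. \<theta> (p + q) = \<theta> p + \<theta> q"
  shows "ore_lin \<theta> e (f + g) = ore_lin \<theta> e f + ore_lin \<theta> e g"
  by (simp add: ore_lin_eq[where n = "max (degree f) (degree g)"] assms degree_add_le
      smult_add_left sum.distrib)

lemma ore_lin_smult:
  assumes "\<theta> 0 = 0" "\<And>p q. \<theta> (p * q) = \<theta> p * \<theta> q"
  shows "ore_lin \<theta> e (smult a f) = smult (\<theta> a) (ore_lin \<theta> e f)"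
proof (induction f arbitrary: e)
  case (pCons b f)
  then show ?case
    by (simp add: ore_lin_pCons assms smult_add_right)
qed (simp add: assms)

section \<open>Induction on generators, and elements commuting with a constant\<close>

context ore_data
begin

lemma L_pCons: "L (pCons a g) = pCons (d a) (L g) + [:0, a:]"
  by (rule poly_eqI) (simp add: coeff_L coeff_pCons split: nat.split)

lemma M_t_right: "M f [:0, 1:] = pCons 0 f"
proof -
  have "M f [:0, 1:] = M (pCons 0 f) 1"
    using L_pow_1[of 1] by (simp add: M_pCons monom_Suc one_pCons)
  then show ?thesis by (simp add: M_1_right)
qed

lemma M_0_right [simp]: "M f 0 = 0"
  using M_add_right[of f 0 0] by simp

lemma M_diff_right: "M f (g - k) = M f g - M f k"
  using M_add_right[of f "g - k" k] by (simp add: algebra_simps)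

lemma M_diff_left: "M (f - g) k = M f k - M g k"
  using M_add_left[of "f - g" g k] by (simp add: algebra_simps)

lemma L_const: "L [:a:] = [:d a, a:]"
  by (simp add: L_pCons)

text \<open>Right multiplication by t is \<open>pCons 0\<close>, so \<open>pCons a f\<close> equals
  \<open>[:a:] + M f [:0, 1:]\<close>, and \<open>C\<close> together with t generates. The cases
  \<open>add\<close> and \<open>mult\<close> carry membership of the coefficients in
  \<open>C\<close>, so that the rule applies to maps that are multiplicative on the carrier
  only.\<close>

lemma ore_induct [consumes 1, case_names const t add mult]:
  assumes "\<forall>i. coeff f i \<in> C"
    and const: "\<And>c. c \<in> C \<Longrightarrow> P [:c:]"
    and t: "P [:0, 1:]"
    and add: "\<And>f g. \<forall>i. coeff f i \<in> C \<Longrightarrow> \<forall>i. coeff g i \<in> C \<Longrightarrow> P f \<Longrightarrow> P g \<Longrightarrow> P (f + g)"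
    and mult: "\<And>f g. \<forall>i. coeff f i \<in> C \<Longrightarrow> \<forall>i. coeff g i \<in> C \<Longrightarrow> P f \<Longrightarrow> P g \<Longrightarrow> P (M f g)"
  shows "P f"
  using assms(1)
proof (induction f)
  case 0
  show ?case using const[of 0] by simp
next
  case (pCons a f)
  have a: "a \<in> C" using pCons.prems by (metis coeff_pCons_0)
  have f: "\<forall>i. coeff f i \<in> C" using pCons.prems by (metis coeff_pCons_Suc)
  have t': "\<forall>i. coeff [:0, 1:] i \<in> C" by (auto simp: coeff_pCons C_1 split: nat.split)
  have "P ([:a:] + M f [:0, 1:])"
    by (intro add mult const a f t t' pCons.IH M_closed)
      (use a in \<open>auto simp: coeff_pCons split: nat.split\<close>)
  then show ?case by (simp add: M_t_right)
qed

text \<open>Each further multiplication by t adds \<open>d\<close> of the leading coefficient to the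
  next one, so the second coefficient grows by \<open>d c\<close> at every step. It needs the
  leading coefficient, hence one joint induction; the last clause speaks of \<open>Suc i\<close> to
  avoid a predecessor.\<close>

lemma coeff_L_pow_const:
  "(\<forall>j>i. coeff ((L ^^ i) [:c:]) j = 0) \<and> coeff ((L ^^ i) [:c:]) i = c \<and>
    coeff ((L ^^ Suc i) [:c:]) i = of_nat (Suc i) * d c"
proof (induction i)
  case 0
  show ?case by (auto simp: coeff_L coeff_pCons split: nat.split)
next
  case (Suc i)
  have 1: "\<forall>j>Suc i. coeff ((L ^^ Suc i) [:c:]) j = 0"
    using Suc by (auto simp: coeff_L split: nat.split)
  have 2: "coeff ((L ^^ Suc i) [:c:]) (Suc i) = c"
    using Suc by (auto simp: coeff_L)
  have "coeff ((L ^^ Suc (Suc i)) [:c:]) (Suc i) = coeff ((L ^^ Suc i) [:c:]) i + d (coeff ((L ^^ Suc i) [:c:]) (Suc i))"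
    by (subst funpow.simps) (simp add: coeff_L del: funpow.simps)
  also have "\<dots> = of_nat (Suc (Suc i)) * d c"
    using Suc 2 by (simp add: algebra_simps)
  finally show ?case using 1 2 by blast
qed

text \<open>If \<open>f\<close> has degree n + 1, the t^n coefficient of f c - c f is (n + 1) d(c)
  times the leading coefficient of \<open>f\<close>. The assumption \<open>nz\<close> packs what is
  needed of the characteristic, of \<open>d c\<close> and of zero divisors to make this
  nonzero.\<close>

lemma commute_const_imp_degree_0:
  assumes comm: "M f [:c:] = smult c f"
    and nz: "\<And>n b. b \<noteq> 0 \<Longrightarrow> of_nat (Suc n) * d c * b \<noteq> 0"
  shows "degree f = 0"
proof (rule ccontr)
  assume "degree f \<noteq> 0"
  then obtain n where n: "degree f = Suc n" by (cases "degree f") auto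
  have low: "coeff ((L ^^ i) [:c:]) n = 0" if "i < n" for i
    using coeff_L_pow_const[of i c] that by blast
  have "coeff (M f [:c:]) n = (\<Sum>i\<le>Suc n. coeff f i * coeff ((L ^^ i) [:c:]) n)"
    by (simp only: ore_mult_def n coeff_sum coeff_smult)
  also have "\<dots> = (\<Sum>i<n. coeff f i * coeff ((L ^^ i) [:c:]) n) + coeff f n * c
      + coeff f (Suc n) * (of_nat (Suc n) * d c)"
    using coeff_L_pow_const[of n c] by (simp add: lessThan_Suc_atMost[symmetric] del: funpow.simps)
  also have "(\<Sum>i<n. coeff f i * coeff ((L ^^ i) [:c:]) n) = 0"
    by (intro sum.neutral) (simp add: low)
  finally have "of_nat (Suc n) * d c * coeff f (Suc n) = 0"
    using comm by (simp add: algebra_simps)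
  moreover have "coeff f (Suc n) \<noteq> 0"
    using n by (metis degree_0 leading_coeff_0_iff nat.distinct(1))
  ultimately show False using nz by blast
qed

end

section \<open>Endomorphisms that twist the coefficients and send t to c + b t\<close>

locale ore_hom = ore_data +
  fixes \<theta> :: "'a \<Rightarrow> 'a" and c b :: 'a
  assumes \<theta>_add: "\<theta> (p + q) = \<theta> p + \<theta> q"
    and \<theta>_mult: "\<theta> (p * q) = \<theta> p * \<theta> q"
    and \<theta>_1: "\<theta> 1 = 1"
    and \<theta>_d: "b * d (\<theta> p) = \<theta> (d p)"
    and \<theta>_C: "p \<in> C \<Longrightarrow> \<theta> p \<in> C"
    and c_C: "c \<in> C" and b_C: "b \<in> C"
begin

definition Y :: "'a poly \<Rightarrow> 'a poly" where
  "Y g = smult c g + smult b (L g)"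

text \<open>\<open>act f k\<close> is the product of the image of \<open>f\<close> with \<open>k\<close>.\<close>

definition act :: "'a poly \<Rightarrow> 'a poly \<Rightarrow> 'a poly" where
  "act f k = ore_lin \<theta> (\<lambda>i. (Y ^^ i) k) f"

definition \<Phi> :: "'a poly \<Rightarrow> 'a poly" where
  "\<Phi> f = act f 1"

lemma \<theta>_0 [simp]: "\<theta> 0 = 0"
  using \<theta>_add[of 0 0] by simp

lemma Y_M: "Y g = M [:c, b:] g"
  by (simp add: Y_def M_pCons)

lemma Y_add: "Y (f + g) = Y f + Y g"
  by (simp add: Y_M M_add_right)

lemma Y_0 [simp]: "Y 0 = 0"
  by (simp add: Y_M)

text \<open>\<open>Y\<close> is left multiplication by the image of t, so this is the image of the
  relation t p = p t + d p. The compatibility \<open>\<theta>_d\<close> makes it hold.\<close>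

lemma Y_smult: "Y (smult (\<theta> p) g) = smult (\<theta> p) (Y g) + smult (\<theta> (d p)) g"
  by (simp add: Y_def L_smult smult_add_right \<theta>_d[symmetric] mult.commute)

lemma act_0 [simp]: "act 0 k = 0"
  by (simp add: act_def)

lemma act_pCons: "act (pCons a f) k = smult (\<theta> a) k + act f (Y k)"
  by (simp add: act_def ore_lin_pCons funpow_swap1)

lemma act_add: "act (f + g) k = act f k + act g k"
  by (simp add: act_def ore_lin_add \<theta>_add)

lemma act_smult: "act (smult p f) k = smult (\<theta> p) (act f k)"
  by (simp add: act_def ore_lin_smult \<theta>_mult)

lemma act_L: "act (L g) k = Y (act g k)"
proof (induction g arbitrary: k)
  case (pCons a g)
  then show ?case
    by (simp add: L_pCons act_add act_pCons Y_add Y_smult)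
qed simp

lemma act_M: "act (M f g) k = act f (act g k)"
proof (induction f arbitrary: g k)
  case (pCons a f)
  then show ?case
    by (simp add: M_pCons act_add act_smult act_pCons act_L)
qed simp

text \<open>\<open>act f\<close> is composed of left multiplications, which commute with right
  multiplication by associativity. For k = 1 this turns \<open>act f\<close> into left
  multiplication by \<open>\<Phi> f\<close>, and \<open>act_M\<close> into multiplicativity of
  \<open>\<Phi>\<close>.\<close>

lemma M_act: "M (act f k) l = act f (M k l)"
  by (induction f arbitrary: k) (simp_all add: act_pCons M_add_left M_smult Y_M M_assoc)

lemma act_eq: "act f k = M (\<Phi> f) k"
  using M_const[of 1 k] by (simp add: \<Phi>_def M_act one_pCons)

lemma \<Phi>_add: "\<Phi> (f + g) = \<Phi> f + \<Phi> g"
  by (simp add: \<Phi>_def act_add)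

lemma \<Phi>_M: "\<Phi> (M f g) = M (\<Phi> f) (\<Phi> g)"
proof -
  have "\<Phi> (M f g) = act f (\<Phi> g)"
    by (simp add: \<Phi>_def act_M)
  then show ?thesis by (simp add: act_eq)
qed

lemma \<Phi>_const: "\<Phi> [:p:] = [:\<theta> p:]"
  by (simp add: \<Phi>_def act_pCons)

lemma \<Phi>_linear: "\<Phi> [:p, q:] = [:\<theta> p + \<theta> q * c, \<theta> q * b:]"
  by (simp add: \<Phi>_def act_pCons Y_M M_1_right \<theta>_1 flip: one_pCons)

lemma \<Phi>_t: "\<Phi> [:0, 1:] = [:c, b:]"
  using \<Phi>_linear[of 0 1] by (simp add: \<theta>_1)

lemma \<Phi>_closed:
  assumes "\<forall>i. coeff f i \<in> C"
  shows "\<forall>i. coeff (\<Phi> f) i \<in> C"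
  using assms
proof (induction rule: ore_induct)
  case t
  show ?case using c_C b_C by (auto simp: \<Phi>_t coeff_pCons split: nat.split)
qed (auto simp: \<Phi>_const \<theta>_C coeff_pCons \<Phi>_add C_add \<Phi>_M M_closed split: nat.split)

end

text \<open>By multiplicativity only constants and t matter. The last two conditions in
  \<open>inv\<close> say that the first map sends c' + b' t to t.\<close>

lemma ore_hom_inverse:
  fixes C :: "'r::comm_ring_1 set"
  assumes "ore_hom C d \<theta> c b" "ore_hom C d \<theta>' c' b'"
    and inv: "\<And>p. \<theta> (\<theta>' p) = p" "\<theta> c' + \<theta> b' * c = 0" "\<theta> b' * b = 1"
  shows "ore_hom.\<Phi> d \<theta> c b (ore_hom.\<Phi> d \<theta>' c' b' f) = f"
proof -
  interpret f: ore_hom C d \<theta> c b by fact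
  interpret g: ore_hom C d \<theta>' c' b' by fact
  \<comment> \<open>Over \<open>UNIV\<close> the induction reaches every polynomial, also those with
    coefficients outside \<open>C\<close>.\<close>
  interpret U: ore_data UNIV d
    by unfold_locales (auto simp: f.d_add f.d_mult)
  show ?thesis
    by (rule U.ore_induct[of f])
      (auto simp: g.\<Phi>_const f.\<Phi>_const inv g.\<Phi>_t f.\<Phi>_linear f.\<Phi>_add g.\<Phi>_add f.\<Phi>_M g.\<Phi>_M)
qed

text \<open>The second homomorphism is the inverse; restriction to the carrier yields the
  extensional function that \<open>Bij\<close> asks for.\<close>

lemma ore_hom_aut:
  fixes C :: "'r::comm_ring_1 set"
  assumes "ore_hom C d \<theta> c b" "ore_hom C d \<theta>' c' b'"
    and "\<And>p. \<theta> (\<theta>' p) = p" "\<theta> c' + \<theta> b' * c = 0" "\<theta> b' * b = 1"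
    and "\<And>p. \<theta>' (\<theta> p) = p" "\<theta>' c + \<theta>' b * c' = 0" "\<theta>' b * b' = 1"
    and \<kappa>: "\<And>x. \<theta> (\<kappa> x) = \<kappa> x" "\<And>x. \<kappa> x \<in> C"
  shows "restrict (ore_hom.\<Phi> d \<theta> c b) (carrier (ore_extension C d)) \<in>
      alg_Aut (\<lambda>x. [:\<kappa> x:]) (ore_extension C d)"
proof -
  interpret f: ore_hom C d \<theta> c b by fact
  interpret g: ore_hom C d \<theta>' c' b' by fact
  have 1: "f.\<Phi> (g.\<Phi> k) = k" for k
    by (rule ore_hom_inverse) fact+
  have 2: "g.\<Phi> (f.\<Phi> k) = k" for k
    by (rule ore_hom_inverse) fact+
  let ?S = "{f. \<forall>i. coeff f i \<in> C}"
  have bij: "bij_betw f.\<Phi> ?S ?S"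
    by (rule bij_betw_byWitness[where f' = "g.\<Phi>"])
      (use 1 2 f.\<Phi>_closed g.\<Phi>_closed in auto)
  have one: "\<forall>i. coeff (1::'r poly) i \<in> C"
    by (auto simp: coeff_1 f.C_1)
  have const: "\<forall>i. coeff [:\<kappa> x:] i \<in> C" for x
    using \<kappa>(2) by (auto simp: coeff_pCons split: nat.split)
  have f1: "f.\<Phi> 1 = 1"
    using f.\<Phi>_const[of 1] by (simp add: f.\<theta>_1 one_pCons)
  show ?thesis
    unfolding alg_Aut_def Bij_def ring_hom_def
    using bij f.\<Phi>_closed f.C_add f.M_closed one f1 const \<kappa>(1)
    by (auto simp: f.\<Phi>_add f.\<Phi>_M f.\<Phi>_const)
qed

section \<open>Derivations vanishing on coefficients; commutators modulo h\<close>

context ore_data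
begin

text \<open>The value at t^i that the Leibniz rule for t^(i+1) = t t^i forces on a derivation with t
  going to \<open>s\<close>.\<close>

primrec t_der_pow :: "'r \<Rightarrow> nat \<Rightarrow> 'r poly" where
  "t_der_pow s 0 = 0"
| "t_der_pow s (Suc i) = L (t_der_pow s i) + smult s (monom 1 i)"

definition t_der :: "'r \<Rightarrow> 'r poly \<Rightarrow> 'r poly" where
  "t_der s f = ore_lin (\<lambda>p. p) (t_der_pow s) f"

text \<open>The Leibniz rule for t on the left, abstract in both families because the induction
  shifts them. It is applied to \<open>t_der_pow s\<close> and the powers of t.\<close>

lemma ore_lin_L:
  assumes "\<And>i. e (Suc i) = L (e i) + smult s (m i)" "\<And>i. m (Suc i) = L (m i)"
  shows "ore_lin (\<lambda>p. p) e (L g) = L (ore_lin (\<lambda>p. p) e g) + smult s (ore_lin (\<lambda>p. p) m g)"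
  using assms
proof (induction g arbitrary: e m)
  case (pCons a g)
  have "ore_lin (\<lambda>p. p) (\<lambda>i. e (Suc i)) (L g) =
      L (ore_lin (\<lambda>p. p) (\<lambda>i. e (Suc i)) g) + smult s (ore_lin (\<lambda>p. p) (\<lambda>i. m (Suc i)) g)"
    by (rule pCons.IH) (use pCons.prems in auto)
  then show ?case
    using pCons.prems(1)[of 0]
    by (simp add: L_pCons ore_lin_pCons ore_lin_add L_add L_smult smult_add_right mult.commute)
qed simp

lemma t_der_add: "t_der s (f + g) = t_der s f + t_der s g"
  by (simp add: t_der_def ore_lin_add)

lemma t_der_smult: "t_der s (smult a f) = smult a (t_der s f)"
  by (simp add: t_der_def ore_lin_smult)

lemma t_der_const: "t_der s [:a:] = 0"
  by (simp add: t_der_def ore_lin_pCons)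

lemma t_der_L: "t_der s (L g) = L (t_der s g) + smult s g"
proof -
  have "ore_lin (\<lambda>p. p) (monom 1) g = g"
    by (simp add: ore_lin_def smult_monom poly_as_sum_of_monoms)
  then show ?thesis
    using ore_lin_L[of "t_der_pow s" s "monom 1" g] L_pow_1
    by (simp add: t_der_def) (metis funpow.simps(2) o_apply)
qed

lemma M_1_left: "M 1 g = g"
  using M_const[of 1 g] by (simp flip: one_pCons)

lemma t_der_t: "t_der s [:0, 1:] = [:s:]"
  using t_der_L[of s 1] L_pow_1[of 1] t_der_const[of s 1]
  by (simp add: monom_Suc flip: one_pCons)

text \<open>The induction for general products rewrites (a + f t) g as a g + f (t g), so the rule is
  also needed for t on the right. It is checked on powers of t and extended linearly.\<close>

lemma t_der_M_t: "t_der s (pCons 0 f) = M (t_der s f) [:0, 1:] + M f [:s:]"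
proof -
  have "t_der_pow s (Suc i) = M (t_der_pow s i) [:0, 1:] + M (monom 1 i) [:s:]" for i
  proof (induction i)
    case 0
    show ?case by (simp add: M_1_left monom_0 flip: one_pCons)
  next
    case (Suc i)
    have "L (monom 1 i) = monom 1 (Suc i)"
      by (metis L_pow_1 funpow.simps(2) o_apply)
    moreover have "M (monom 1 i) [:0, 1:] = monom 1 (Suc i)"
      by (simp add: M_t_right monom_Suc)
    moreover have "L (t_der_pow s (Suc i)) = M (L (t_der_pow s i)) [:0, 1:] + M (L (monom 1 i)) [:s:]"
      by (simp only: Suc L_add L_M)
    ultimately show ?case
      by (simp only: t_der_pow.simps(2)[of s "Suc i"] t_der_pow.simps(2)[of s i] M_add_left M_smult)
        (simp add: algebra_simps)
  qed
  then have "t_der s (pCons 0 f) =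
      ore_lin (\<lambda>p. p) (\<lambda>i. M (t_der_pow s i) [:0, 1:] + M (monom 1 i) [:s:]) f"
    by (simp add: t_der_def ore_lin_pCons del: t_der_pow.simps)
  also have "\<dots> = M (t_der s f) [:0, 1:] + M (ore_lin (\<lambda>p. p) (monom 1) f) [:s:]"
  proof -
    have "ore_lin (\<lambda>p. p) (\<lambda>i. M (u i) k + M (v i) l) f
        = M (ore_lin (\<lambda>p. p) u f) k + M (ore_lin (\<lambda>p. p) v f) l" for u v k l
      by (induction f arbitrary: u v)
        (simp_all add: ore_lin_pCons M_add_left M_smult smult_add_right)
    then show ?thesis by (simp add: t_der_def)
  qed
  also have "ore_lin (\<lambda>p. p) (monom 1) f = f"
    by (simp add: ore_lin_def smult_monom poly_as_sum_of_monoms)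
  finally show ?thesis .
qed

lemma t_der_M: "t_der s (M f g) = M (t_der s f) g + M f (t_der s g)"
proof (induction f arbitrary: g)
  case 0
  show ?case by (simp add: t_der_const[of s 0, simplified])
next
  case (pCons a f)
  have *: "t_der s (pCons a f) = M (t_der s f) [:0, 1:] + M f [:s:]"
    using t_der_add[of s "[:a:]" "pCons 0 f"] by (simp add: t_der_const t_der_M_t)
  show ?case
    by (simp add: * M_pCons t_der_add t_der_smult pCons.IH t_der_L M_add_left M_add_right
        M_assoc M_t M_const)
qed

text \<open>Modulo \<open>h\<close>, the algebra \<open>R[t; d]\<close> is commutative if \<open>d\<close> takes values in \<open>hR\<close>.\<close>

lemma dvd_M_minus_mult:
  assumes "\<And>p. h dvd d p"
  shows "[:h:] dvd M f g - f * g"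
proof (induction f arbitrary: g)
  case (pCons a f)
  have "[:h:] dvd map_poly d g"
  proof (induction g)
    case (pCons x g)
    from assms obtain y where "d x = h * y" by (auto elim: dvdE)
    moreover from pCons.IH obtain q where "map_poly d g = [:h:] * q" by (auto elim: dvdE)
    ultimately have "map_poly d (pCons x g) = [:h:] * pCons y q"
      by (simp add: map_poly_pCons)
    then show ?case by (rule dvdI)
  qed simp
  \<comment> \<open>\<open>L g\<close> differs from the commutative product of t and
    \<open>g\<close> by \<open>map_poly d g\<close>, which is divisible by \<open>[:h:]\<close>; the
    other summand is the induction hypothesis at \<open>L g\<close>.\<close>
  moreover have "M (pCons a f) g - pCons a f * g = (M f (L g) - f * L g) + f * map_poly d g"
    by (simp add: M_pCons ore_t_mult_def algebra_simps)
  ultimately show ?case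
    using pCons.IH[of "L g"] by (metis dvd_add dvd_mult)
qed simp

lemma dvd_commutator:
  assumes "\<And>p. h dvd d p"
  shows "[:h:] dvd M f g - M g f"
  using dvd_diff[OF dvd_M_minus_mult[OF assms, of f g] dvd_M_minus_mult[OF assms, of g f]]
  by (simp add: mult.commute)

end

section \<open>Generators of A_h and the derivation Delta\<close>

abbreviation (input) MA :: "'a::field poly \<Rightarrow> 'a poly poly \<Rightarrow> 'a poly poly \<Rightarrow> 'a poly poly" where
  "MA h \<equiv> ore_mult (\<lambda>p. h * pderiv p)"

lemma alg_A_mult [simp]: "f \<otimes>\<^bsub>alg_A h\<^esub> g = MA h f g"
  by (simp add: alg_A_def)

lemma carrier_alg_A [simp]: "carrier (alg_A h) = UNIV"
  by (simp add: alg_A_def)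

lemma alg_A_add [simp]: "f \<oplus>\<^bsub>alg_A h\<^esub> g = f + g"
  by (simp add: alg_A_def)

text \<open>Scalars and x generate all \<open>[:p:]\<close>, and t generates the rest over them.
  Maps on A_h are compared on generators through this rule.\<close>

lemma alg_A_induct [case_names const x t add mult]:
  assumes const: "\<And>c. P [:[:c:]:]" and x: "P gen_x" and t: "P gen_t"
    and add: "\<And>f g. P f \<Longrightarrow> P g \<Longrightarrow> P (f + g)"
    and mult: "\<And>f g. P f \<Longrightarrow> P g \<Longrightarrow> P (MA h f g)"
  shows "P f"
proof -
  interpret ore_data UNIV "\<lambda>p. h * pderiv p" by (rule ore_data_A)
  have "P [:p:]" for p
  proof (induction p)
    case 0
    show ?case using const[of 0] by simp
  next
    case (pCons c p)
    have "P ([:[:c:]:] + M gen_x [:p:])"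
      by (intro add mult const x pCons.IH)
    then show ?case by (simp add: gen_x_def M_const)
  qed
  then show ?thesis
    using t by (intro ore_induct[of f P]) (auto intro: add mult simp: gen_t_def)
qed

text \<open>A derivation kills 1 because 1 = 1 * 1, hence kills scalars, and is then determined at x
  and t. So the description in \<open>Delta\<close> denotes \<open>t_der s\<close>.\<close>

lemma
  shows Delta_in_Der: "Delta h s \<in> Der_A h"
    and Delta_const: "Delta h s [:p:] = 0"
    and Delta_t: "Delta h s gen_t = [:s:]"
proof -
  interpret ore_data UNIV "\<lambda>p. h * pderiv p" by (rule ore_data_A)
  have eq: "Delta h s = t_der s"
    unfolding Delta_def
  proof (rule the_equality)
    show "t_der s \<in> Der_A h \<and> t_der s gen_x = 0 \<and> t_der s gen_t = [:s:]"
      by (simp add: Der_A_def t_der_add t_der_smult t_der_M gen_x_def gen_t_def t_der_const t_der_t)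
    fix \<delta> assume \<delta>: "\<delta> \<in> Der_A h \<and> \<delta> gen_x = 0 \<and> \<delta> gen_t = [:s:]"
    then have D: "\<And>f g. \<delta> (f + g) = \<delta> f + \<delta> g" "\<And>c f. \<delta> (smult [:c:] f) = smult [:c:] (\<delta> f)"
      "\<And>f g. \<delta> (M f g) = M (\<delta> f) g + M f (\<delta> g)"
      by (auto simp: Der_A_def)
    have "\<delta> 1 = 0"
      using D(3)[of 1 1] M_const[of 1] by (simp add: M_1_right flip: one_pCons)
    then have const: "\<delta> [:[:c:]:] = 0" for c
      using D(2)[of c 1] by simp
    show "\<delta> = t_der s"
    proof
      fix f show "\<delta> f = t_der s f"
        by (rule alg_A_induct[of "\<lambda>f. \<delta> f = t_der s f" h])
          (use \<delta> in \<open>auto simp: const t_der_const gen_x_def gen_t_def t_der_t D t_der_add t_der_M\<close>)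
    qed
  qed
  show "Delta h s \<in> Der_A h"
    by (simp add: eq Der_A_def t_der_add t_der_smult t_der_M)
  show "Delta h s [:p:] = 0" "Delta h s gen_t = [:s:]"
    by (simp_all add: eq t_der_const t_der_t gen_t_def)
qed

section \<open>The inclusion of A_h in B\<close>

lemma A_to_B_add: "A_to_B (f + g) = A_to_B f + A_to_B g"
  by (rule poly_eqI) (simp add: A_to_B_def coeff_map_poly)

lemma A_to_B_diff: "A_to_B (f - g) = A_to_B f - A_to_B g"
  by (rule poly_eqI) (simp add: A_to_B_def coeff_map_poly)

lemma A_to_B_0 [simp]: "A_to_B 0 = 0"
  by (simp add: A_to_B_def)

lemma A_to_B_pCons: "A_to_B (pCons p f) = pCons (to_fract p) (A_to_B f)"
  by (simp add: A_to_B_def map_poly_pCons)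

lemma A_to_B_smult: "A_to_B (smult p f) = smult (to_fract p) (A_to_B f)"
  by (rule poly_eqI) (simp add: A_to_B_def coeff_map_poly)

lemma A_to_B_eq_iff [simp]: "A_to_B f = A_to_B g \<longleftrightarrow> f = g"
  by (auto simp: A_to_B_def poly_eq_iff coeff_map_poly)

lemma A_to_B_t: "A_to_B gen_t = [:0, 1:]"
  by (simp add: gen_t_def A_to_B_pCons)

lemma A_to_B_const: "A_to_B [:p:] = [:to_fract p:]"
  by (simp add: A_to_B_pCons)

lemma to_fract_in_R_S: "to_fract p \<in> R_S h"
  by (rule R_S_I[of _ p h 0]) simp

lemma A_to_B_closed: "coeff (A_to_B f) i \<in> R_S h"
  by (simp add: A_to_B_def coeff_map_poly to_fract_in_R_S)

lemma A_to_B_mult: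
  assumes "h \<noteq> 0"
  shows "A_to_B (MA h f g) = ore_mult (d_S h) (A_to_B f) (A_to_B g)"
proof -
  interpret A: ore_data UNIV "\<lambda>p. h * pderiv p" by (rule ore_data_A)
  interpret B: ore_data "R_S h" "d_S h" by (rule ore_data_B) fact
  have L: "A_to_B (A.L g) = B.L (A_to_B g)" for g
    by (rule poly_eqI)
      (simp add: A_to_B_def coeff_map_poly A.coeff_L B.coeff_L d_S_to_fract split: nat.split)
  show ?thesis
    by (induction f arbitrary: g)
      (simp_all add: A_to_B_pCons A.M_pCons B.M_pCons A_to_B_add A_to_B_smult L)
qed

lemma alg_B_mult [simp]: "f \<otimes>\<^bsub>alg_B h\<^esub> g = ore_mult (d_S h) f g"
  by (simp add: alg_B_def)

lemma carrier_alg_B: "carrier (alg_B h) = {f. \<forall>i. coeff f i \<in> R_S h}"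
  by (simp add: alg_B_def)

section \<open>Denominators psi and the derivation E_H\<close>

lemma psi_nonzero: "h \<noteq> 0 \<Longrightarrow> psi h \<noteq> 0"
  by (simp add: psi_def)

text \<open>With h = psi q one has h' = psi q' + q psi', so psi divides q psi'; multiply by psi.
  This makes d_S(1/psi) = - h psi' / psi^2 a polynomial.\<close>

lemma psi_square_dvd:
  fixes h :: "'a::field_gcd poly"
  shows "psi h * psi h dvd h * pderiv (psi h)"
proof -
  have "psi h dvd h" by (simp add: psi_def)
  then obtain q where q: "h = psi h * q" by (auto elim: dvdE)
  have "psi h dvd pderiv h" by (simp add: psi_def)
  moreover have "pderiv h = psi h * pderiv q + q * pderiv (psi h)"
    by (subst q) (simp only: pderiv_mult)
  ultimately have "psi h dvd q * pderiv (psi h)"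
    by (metis dvd_add_right_iff dvd_triv_left)
  then have "psi h * psi h dvd psi h * (q * pderiv (psi h))"
    by (rule mult_dvd_mono[OF dvd_refl])
  also have "psi h * (q * pderiv (psi h)) = h * pderiv (psi h)"
    using q by (metis mult.assoc)
  finally show ?thesis .
qed

lemma d_S_inverse_psi:
  fixes h :: "'a::field_gcd poly"
  assumes "h \<noteq> 0"
  shows "\<exists>k. d_S h (inverse (to_fract (psi h))) = to_fract k"
proof -
  interpret B: ore_data "R_S h" "d_S h" by (rule ore_data_B) fact
  obtain k where k: "h * pderiv (psi h) = psi h * psi h * k"
    using psi_square_dvd[of h] by (auto elim: dvdE)
  define P where "P = to_fract (psi h)"
  have P: "P \<noteq> 0" using psi_nonzero[OF assms] by (simp add: P_def)
  have "d_S h P * inverse P + P * d_S h (inverse P) = 0"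
    using B.d_mult[of P "inverse P"] P by simp
  moreover have "d_S h P = P * P * to_fract k"
    by (simp add: P_def d_S_to_fract k)
  ultimately have "P * (to_fract k + d_S h (inverse P)) = 0"
    using P by (simp add: field_simps)
  then have "d_S h (inverse P) = to_fract (- k)"
    using P by (simp add: eq_neg_iff_add_eq_0 add.commute)
  then show ?thesis unfolding P_def ..
qed

lemma psi_inv_mult_eq: "h \<noteq> 0 \<Longrightarrow> psi_inv_mult h H = smult (inverse (to_fract (psi h))) (A_to_B H)"
  using ore_data.M_const[OF ore_data_B] by (simp add: psi_inv_mult_def)

text \<open>For v = 1/psi, [v H, f] = v [H, f] + [v, f] H. The commutator [H, f] is divisible by h
  and v h is a polynomial, so the first summand lies in A_h; the second does because [v, f]
  does.\<close>

lemma ad_psi_inv_in_A: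
  fixes h :: "'a::field_gcd poly"
  assumes "h \<noteq> 0"
  shows "ad_B h (psi_inv_mult h H) (A_to_B f) \<in> range A_to_B"
proof -
  interpret A: ore_data UNIV "\<lambda>p. h * pderiv p" by (rule ore_data_A)
  interpret B: ore_data "R_S h" "d_S h" by (rule ore_data_B) fact
  define v where "v = inverse (to_fract (psi h))"
  have nz: "to_fract (psi h) \<noteq> 0" using psi_nonzero[OF assms] by simp
  \<comment> \<open>By the Leibniz rule it suffices to treat generators: [v, -] kills the
    coefficients and takes t to - d_S(v), a polynomial.\<close>
  have v: "B.M [:v:] (A_to_B f) - B.M (A_to_B f) [:v:] \<in> range A_to_B"
  proof (rule A.ore_induct[of f], goal_cases _ const t add mult)
    case (const c)
    then show ?case by (auto simp: A_to_B_const B.M_const mult.commute intro: range_eqI[of _ _ 0])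
  next
    case t
    obtain k where k: "d_S h v = to_fract k"
      using d_S_inverse_psi[OF assms] by (auto simp: v_def)
    have "B.M [:v:] (A_to_B [:0, 1:]) - B.M (A_to_B [:0, 1:]) [:v:] = A_to_B [:- k:]"
      by (simp add: A_to_B_pCons B.M_const B.M_t B.L_const k)
    then show ?case by blast
  next
    case (add f g)
    then obtain f' g' where "B.M [:v:] (A_to_B f) - B.M (A_to_B f) [:v:] = A_to_B f'"
      "B.M [:v:] (A_to_B g) - B.M (A_to_B g) [:v:] = A_to_B g'" by auto
    then have "B.M [:v:] (A_to_B (f + g)) - B.M (A_to_B (f + g)) [:v:] = A_to_B (f' + g')"
      by (simp add: A_to_B_add B.M_add_left B.M_add_right algebra_simps)
    then show ?case by blast
  next
    case (mult f g)
    then obtain f' g' where *: "B.M [:v:] (A_to_B f) - B.M (A_to_B f) [:v:] = A_to_B f'"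
      "B.M [:v:] (A_to_B g) - B.M (A_to_B g) [:v:] = A_to_B g'" by auto
    have "B.M [:v:] (A_to_B (A.M f g)) - B.M (A_to_B (A.M f g)) [:v:]
        = A_to_B (A.M f' g + A.M f g')"
      by (simp add: A_to_B_add A_to_B_mult[OF assms] *[symmetric] B.M_diff_left B.M_diff_right
          B.M_assoc)
    then show ?case by blast
  qed simp
  then obtain f' where f': "B.M [:v:] (A_to_B f) - B.M (A_to_B f) [:v:] = A_to_B f'" by auto
  have "psi h dvd h" by (simp add: psi_def)
  then obtain q where q: "h = psi h * q" by (auto elim: dvdE)
  have vh: "v * to_fract h = to_fract q"
    using arg_cong[OF q, of to_fract] nz by (simp add: v_def)
  have "[:h:] dvd A.M H f - A.M f H"
    by (rule A.dvd_commutator) simp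
  then obtain g where g: "A.M H f - A.M f H = [:h:] * g" by (auto elim: dvdE)
  have "B.M (A_to_B H) (A_to_B f) - B.M (A_to_B f) (A_to_B H) = A_to_B (smult h g)"
    using arg_cong[OF g, of A_to_B] by (simp add: A_to_B_diff A_to_B_mult[OF assms])
  then have "smult v (B.M (A_to_B H) (A_to_B f) - B.M (A_to_B f) (A_to_B H)) = A_to_B (smult q g)"
    using vh by (simp add: A_to_B_smult)
  moreover have "ad_B h (psi_inv_mult h H) (A_to_B f)
      = smult v (B.M (A_to_B H) (A_to_B f) - B.M (A_to_B f) (A_to_B H))
        + B.M (B.M [:v:] (A_to_B f) - B.M (A_to_B f) [:v:]) (A_to_B H)"
    by (simp add: ad_B_def psi_inv_mult_eq[OF assms] v_def[symmetric] B.M_diff_left B.M_assoc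
        B.M_smult B.M_const smult_diff_right)
  ultimately have "ad_B h (psi_inv_mult h H) (A_to_B f) = A_to_B (smult q g + A.M f' H)"
    by (simp add: f' A_to_B_add A_to_B_mult[OF assms])
  then show ?thesis by blast
qed

lemma A_to_B_E_der:
  fixes h :: "'a::field_gcd poly"
  assumes "h \<noteq> 0"
  shows "A_to_B (E_der h H f) = ad_B h (psi_inv_mult h H) (A_to_B f)"
proof -
  obtain g where g: "A_to_B g = ad_B h (psi_inv_mult h H) (A_to_B f)"
    using ad_psi_inv_in_A[OF assms] by (metis imageE)
  show ?thesis
    unfolding E_der_def by (rule theI[of _ g]) (rule g, metis g A_to_B_eq_iff)
qed

section \<open>The substitution of a x for x, on polynomials and fractions\<close>

definition scale :: "'a::field \<Rightarrow> 'a poly \<Rightarrow> 'a poly" where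
  "scale a p = pcompose p [:0, a:]"

lemma scale_add: "scale a (p + q) = scale a p + scale a q"
  by (simp add: scale_def pcompose_add)

lemma scale_diff: "scale a (p - q) = scale a p - scale a q"
  by (simp add: scale_def pcompose_diff)

lemma scale_mult: "scale a (p * q) = scale a p * scale a q"
  by (simp add: scale_def pcompose_mult)

lemma scale_smult: "scale a (smult b p) = smult b (scale a p)"
  by (simp add: scale_def pcompose_smult)

lemma scale_0 [simp]: "scale a 0 = 0"
  by (simp add: scale_def)

lemma scale_const [simp]: "scale a [:b:] = [:b:]"
  by (simp add: scale_def)

lemma scale_1 [simp]: "scale a 1 = 1"
  using scale_const[of a 1] by (simp flip: one_pCons)

lemma scale_power: "scale a (p ^ n) = scale a p ^ n"
  by (induction n) (simp_all add: scale_mult)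

lemma scale_x: "scale a [:0, 1:] = [:0, a:]"
  by (simp add: scale_def pcompose_pCons)

lemma scale_by_1 [simp]: "scale 1 p = p"
  by (simp add: scale_def)

lemma scale_scale: "scale a (scale b p) = scale (b * a) p"
  by (simp add: scale_def pcompose_assoc[symmetric] pcompose_pCons mult.commute)

lemma scale_eq_0_iff [simp]: "a \<noteq> 0 \<Longrightarrow> scale a p = 0 \<longleftrightarrow> p = 0"
  by (metis scale_scale scale_by_1 scale_0 right_inverse)

lemma pderiv_scale: "pderiv (scale a p) = smult a (scale a (pderiv p))"
  by (simp add: scale_def pderiv_pcompose pderiv_pCons)

definition scale_fract :: "'a::field_gcd \<Rightarrow> 'a poly fract \<Rightarrow> 'a poly fract" where
  "scale_fract a u =
     (case quot_of_fract u of (p, q) \<Rightarrow> to_fract (scale a p) / to_fract (scale a q))"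

lemma fract_cases:
  obtains p q where "q \<noteq> 0" "u = to_fract p / to_fract q"
  by (cases u) (auto simp: to_fract_def)

text \<open>Substitution respects cross-multiplied equality and, as \<open>a\<close> is nonzero,
  keeps denominators nonzero. Hence any representative may replace the normalised one of the
  definition.\<close>

lemma scale_fract_div:
  assumes "a \<noteq> 0" "q \<noteq> 0"
  shows "scale_fract a (to_fract p / to_fract q) = to_fract (scale a p) / to_fract (scale a q)"
proof -
  obtain p' q' where pq': "quot_of_fract (to_fract p / to_fract q) = (p', q')"
    by fastforce
  have q': "q' \<noteq> 0"
    using snd_quot_of_fract_nonzero[of "to_fract p / to_fract q"] pq' by simp
  have "Fract p' q' = to_fract p / to_fract q"
    using Fract_quot_of_fract[of "to_fract p / to_fract q"] pq' by simp
  then have "to_fract p' / to_fract q' = to_fract p / to_fract q"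
    using q' by (simp add: to_fract_def)
  then have "to_fract (p' * q) = to_fract (p * q')"
    using assms q' by (simp add: field_simps)
  then have "scale a p' * scale a q = scale a p * scale a q'"
    by (simp only: to_fract_eq_iff flip: scale_mult)
  then have "to_fract (scale a p') * to_fract (scale a q) = to_fract (scale a p) * to_fract (scale a q')"
    by (simp flip: to_fract_mult)
  then show ?thesis
    using assms q' by (simp add: scale_fract_def pq' field_simps)
qed

lemma scale_fract_to_fract: "a \<noteq> 0 \<Longrightarrow> scale_fract a (to_fract p) = to_fract (scale a p)"
  using scale_fract_div[of a 1 p] by simp

lemma scale_fract_add:
  assumes "a \<noteq> 0"
  shows "scale_fract a (u + v) = scale_fract a u + scale_fract a v"
proof -
  obtain p q p' q' where q: "q \<noteq> 0" "q' \<noteq> 0"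
    and uv: "u = to_fract p / to_fract q" "v = to_fract p' / to_fract q'"
    by (metis fract_cases)
  have "u + v = to_fract (p * q' + p' * q) / to_fract (q * q')"
    using q by (simp add: uv add_frac_eq)
  then have "scale_fract a (u + v) = to_fract (scale a (p * q' + p' * q)) / to_fract (scale a (q * q'))"
    using q assms by (simp add: scale_fract_div del: to_fract_add to_fract_mult)
  also have "\<dots> = scale_fract a u + scale_fract a v"
    using q assms by (simp add: uv scale_fract_div scale_add scale_mult add_frac_eq)
  finally show ?thesis .
qed

lemma scale_fract_mult:
  assumes "a \<noteq> 0"
  shows "scale_fract a (u * v) = scale_fract a u * scale_fract a v"
proof -
  obtain p q p' q' where q: "q \<noteq> 0" "q' \<noteq> 0"
    and uv: "u = to_fract p / to_fract q" "v = to_fract p' / to_fract q'"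
    by (metis fract_cases)
  have "u * v = to_fract (p * p') / to_fract (q * q')"
    by (simp add: uv)
  then have "scale_fract a (u * v) = to_fract (scale a (p * p')) / to_fract (scale a (q * q'))"
    using q assms by (simp add: scale_fract_div del: to_fract_mult)
  also have "\<dots> = scale_fract a u * scale_fract a v"
    using q assms by (simp add: uv scale_fract_div scale_mult)
  finally show ?thesis .
qed

lemma scale_fract_scale_fract:
  assumes "a \<noteq> 0" "b \<noteq> 0" "b * a = 1"
  shows "scale_fract a (scale_fract b u) = u"
proof -
  obtain p q where *: "q \<noteq> 0" "u = to_fract p / to_fract q" by (metis fract_cases)
  then show ?thesis using assms by (simp add: scale_fract_div scale_scale)
qed

lemma d_S_div:
  assumes "q \<noteq> 0"
  shows "d_S h (to_fract p / to_fract q) =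
    to_fract (h * (pderiv p * q - p * pderiv q)) / to_fract (q * q)"
proof -
  have "to_fract p / to_fract q = Fract p q"
    using assms by (simp add: to_fract_def)
  then show ?thesis
    using assms by (simp add: d_S_def fract_deriv_Fract to_fract_def)
qed

section \<open>Automorphisms of A_h and B from a symmetry of h\<close>

locale h_symmetry =
  fixes h :: "'a::field_gcd poly" and a :: 'a
  assumes h_nonconst: "degree h > 0" and a_nonzero: "a \<noteq> 0"
    and scale_h: "scale a h = smult (a ^ degree h) h"
begin

lemma h_nonzero: "h \<noteq> 0"
  using h_nonconst by auto

text \<open>The factor on t: of the a^N picked up by h, the chain rule accounts for one
  \<open>a\<close>.\<close>

definition lam :: 'a where
  "lam = a ^ (degree h - 1)"

lemma lam_nonzero: "lam \<noteq> 0"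
  by (simp add: lam_def a_nonzero)

lemma power_degree: "a ^ degree h = a * lam"
  using h_nonconst by (simp add: lam_def power_eq_if)

text \<open>Up to scalars, h and h' are fixed by the substitution, so psi(a x) divides both and
  hence psi. Equal degrees make the quotient constant.\<close>

lemma scale_psi: obtains k where "k \<noteq> 0" "scale a (psi h) = smult k (psi h)"
proof -
  have "smult a (scale a (pderiv h)) = smult (a ^ degree h) (pderiv h)"
    using arg_cong[OF scale_h, of pderiv] by (simp add: pderiv_scale pderiv_smult)
  then have h': "scale a (pderiv h) = smult (inverse a * a ^ degree h) (pderiv h)"
    using a_nonzero by (metis left_inverse smult_1_left smult_smult)
  have sc: "scale a p dvd scale a q" if "p dvd q" for p q :: "'a poly"
    using that by (auto simp: scale_mult elim!: dvdE)
  have "scale a (psi h) dvd h"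
    using sc[of "psi h" h] a_nonzero by (simp add: psi_def scale_h dvd_smult_iff)
  moreover have "scale a (psi h) dvd pderiv h"
    using sc[of "psi h" "pderiv h"] a_nonzero by (simp add: psi_def h' dvd_smult_iff)
  ultimately have "scale a (psi h) dvd psi h"
    by (simp add: psi_def)
  then obtain q where q: "psi h = scale a (psi h) * q" by (auto elim: dvdE)
  have nz: "scale a (psi h) \<noteq> 0" "q \<noteq> 0"
    using q psi_nonzero[OF h_nonzero] by auto
  have "degree (scale a (psi h)) = degree (psi h)"
    using a_nonzero by (simp add: scale_def degree_pcompose)
  then have "degree q = 0"
    using arg_cong[OF q, of degree] nz by (simp add: degree_mult_eq)
  then obtain k where k: "q = [:k:]" by (auto elim: degree_eq_zeroE)
  then have "scale a (psi h) = smult (inverse k) (psi h)"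
    using q nz(2) by (simp add: mult.commute[of _ "[:k:]"]) (metis left_inverse smult_1_left smult_smult)
  then show thesis using that[of "inverse k"] nz(2) k by simp
qed

lemma scale_fract_R_S:
  assumes "u \<in> R_S h"
  shows "scale_fract a u \<in> R_S h"
proof -
  obtain k where k: "k \<noteq> 0" "scale a (psi h) = smult k (psi h)" by (rule scale_psi)
  have Pn: "to_fract (p ^ n) = to_fract p ^ n" for n and p :: "'a poly"
    by (induction n) simp_all
  obtain p n where u: "u = to_fract p / to_fract (psi h) ^ n"
    using assms by (auto simp: R_S_def)
  have "scale_fract a u = to_fract (scale a p) / to_fract (smult k (psi h)) ^ n"
    using psi_nonzero[OF h_nonzero] a_nonzero k(2)
    by (simp add: u scale_fract_div scale_power Pn flip: Pn)
  also have "\<dots> = to_fract (smult (inverse k ^ n) (scale a p)) / to_fract (psi h) ^ n"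
  proof -
    have "scale a p * psi h ^ n = smult (inverse k ^ n) (scale a p) * smult k (psi h) ^ n"
      using k(1) by (simp add: smult_power flip: power_mult_distrib)
    then show ?thesis
      using k(1) psi_nonzero[OF h_nonzero] by (simp add: frac_eq_eq flip: Pn to_fract_mult)
  qed
  finally show ?thesis by (rule R_S_I)
qed

text \<open>The compatibility condition holds since lam h (p(a x))' = lam a h p'(a x) = h(a x) p'(a
  x).\<close>

lemma ore_hom_A: "ore_hom UNIV (\<lambda>p. h * pderiv p) (scale a) c [:lam:]"
proof -
  interpret ore_data UNIV "\<lambda>p. h * pderiv p" by (rule ore_data_A)
  show ?thesis
    by unfold_locales
      (auto simp: scale_add scale_mult pderiv_scale scale_h power_degree mult.commute)
qed

lemma ore_hom_B: "ore_hom (R_S h) (d_S h) (scale_fract a) (to_fract c) (to_fract [:lam:])"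
proof -
  interpret ore_data "R_S h" "d_S h" by (rule ore_data_B[OF h_nonzero])
  have "to_fract [:lam:] * d_S h (scale_fract a u) = scale_fract a (d_S h u)" for u
  proof -
    obtain p q where *: "q \<noteq> 0" "u = to_fract p / to_fract q" by (metis fract_cases)
    have "scale_fract a (d_S h u) =
      to_fract (scale a (h * (pderiv p * q - p * pderiv q))) / to_fract (scale a (q * q))"
      using * a_nonzero by (simp add: d_S_div scale_fract_div del: to_fract_mult)
    \<comment> \<open>Here h contributes a^N = a lam; the factor a is absorbed by differentiating
      the scaled polynomials.\<close>
    also have "scale a (h * (pderiv p * q - p * pderiv q)) = [:lam:] *
       (h * (pderiv (scale a p) * scale a q - scale a p * pderiv (scale a q)))"
      by (simp add: scale_mult scale_diff scale_h pderiv_scale power_degree algebra_simps smult_diff_right)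
    also have "to_fract \<dots> = to_fract [:lam:] * to_fract
       (h * (pderiv (scale a p) * scale a q - scale a p * pderiv (scale a q)))"
      by (rule to_fract_mult)
    also have "\<dots> / to_fract (scale a (q * q)) = to_fract [:lam:] * d_S h (scale_fract a u)"
      using * a_nonzero by (simp add: d_S_div scale_fract_div scale_mult)
    finally show ?thesis ..
  qed
  then show ?thesis
    using a_nonzero scale_fract_to_fract[of a 1]
    by unfold_locales
      (simp_all add: scale_fract_add scale_fract_mult scale_fract_R_S to_fract_in_R_S)
qed

lemma inverse_symmetry: "h_symmetry h (inverse a)"
proof
  have "scale (inverse a) (smult (a ^ degree h) h) = h"
    using a_nonzero by (simp add: scale_h[symmetric] scale_scale)
  then have "smult (a ^ degree h) (scale (inverse a) h) = h"
    by (simp add: scale_smult)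
  then have "smult (inverse a ^ degree h) (smult (a ^ degree h) (scale (inverse a) h))
      = smult (inverse a ^ degree h) h"
    by simp
  then show "scale (inverse a) h = smult (inverse a ^ degree h) h"
    using a_nonzero by (simp flip: power_mult_distrib)
qed (use h_nonconst a_nonzero in auto)

definition aut_A where
  "aut_A c = ore_hom.\<Phi> (\<lambda>p. h * pderiv p) (scale a) c [:lam:]"

definition aut_B where
  "aut_B c = ore_hom.\<Phi> (d_S h) (scale_fract a) (to_fract c) (to_fract [:lam:])"

lemma aut_A_rules:
  "aut_A c (f + g) = aut_A c f + aut_A c g"
  "aut_A c (MA h f g) = MA h (aut_A c f) (aut_A c g)"
  "aut_A c [:p:] = [:scale a p:]"
  "aut_A c gen_t = [:c, [:lam:]:]"
proof -
  interpret ore_hom UNIV "\<lambda>p. h * pderiv p" "scale a" c "[:lam:]" by (rule ore_hom_A)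
  show "aut_A c (f + g) = aut_A c f + aut_A c g"
    "aut_A c (MA h f g) = MA h (aut_A c f) (aut_A c g)"
    "aut_A c [:p:] = [:scale a p:]"
    "aut_A c gen_t = [:c, [:lam:]:]"
    by (simp_all only: gen_t_def aut_A_def \<Phi>_add \<Phi>_M \<Phi>_const \<Phi>_t)
qed

lemma aut_B_rules:
  "aut_B c (f + g) = aut_B c f + aut_B c g"
  "aut_B c (ore_mult (d_S h) f g) = ore_mult (d_S h) (aut_B c f) (aut_B c g)"
  "aut_B c [:u:] = [:scale_fract a u:]"
  "aut_B c [:0, 1:] = [:to_fract c, to_fract [:lam:]:]"
proof -
  interpret ore_hom "R_S h" "d_S h" "scale_fract a" "to_fract c" "to_fract [:lam:]"
    by (rule ore_hom_B)
  show "aut_B c (f + g) = aut_B c f + aut_B c g"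
    "aut_B c (ore_mult (d_S h) f g) = ore_mult (d_S h) (aut_B c f) (aut_B c g)"
    "aut_B c [:u:] = [:scale_fract a u:]"
    "aut_B c [:0, 1:] = [:to_fract c, to_fract [:lam:]:]"
    by (simp_all only: aut_B_def \<Phi>_add \<Phi>_M \<Phi>_const \<Phi>_t)
qed

lemma aut_A_in_Aut: "aut_A c \<in> Aut_A h"
proof -
  interpret inv: h_symmetry h "inverse a" by (rule inverse_symmetry)
  \<comment> \<open>The inverse sends t to c' + lam^(-1) t; solving
    \<open>scale a c' + [:inverse lam:] * c = 0\<close> gives this value.\<close>
  define c' where "c' = - smult (inverse lam) (scale (inverse a) c)"
  have b: "lam \<noteq> 0" "inv.lam = inverse lam"
    by (simp_all add: a_nonzero lam_def inv.lam_def power_inverse)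
  have "scale a (scale (inverse a) c) = c" "scale (inverse a) (scale a p) = p"
    "scale a (scale (inverse a) p) = p" for p
    using a_nonzero by (simp_all add: scale_scale)
  note s = this
  have m: "scale x (- p) = - scale x p" for x and p :: "'a poly"
    using scale_diff[of x 0 p] by simp
  have "restrict (aut_A c) (carrier (alg_A h)) \<in> alg_Aut (\<lambda>x. [:[:x:]:]) (alg_A h)"
    unfolding alg_A_def aut_A_def
    by (rule ore_hom_aut[OF ore_hom_A inv.ore_hom_A[of c']])
      (use b in \<open>simp_all add: s c'_def scale_smult m flip: one_pCons\<close>)
  then show ?thesis by (simp add: Aut_A_def restrict_def)
qed

lemma aut_B_in_Aut: "restrict (aut_B c) (carrier (alg_B h)) \<in> Aut_B h"
proof -
  interpret inv: h_symmetry h "inverse a" by (rule inverse_symmetry)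
  define c' where "c' = - smult (inverse lam) (scale (inverse a) c)"
  have b: "lam \<noteq> 0" "inv.lam = inverse lam"
    by (simp_all add: a_nonzero lam_def inv.lam_def power_inverse)
  have "scale a (scale (inverse a) c) = c" "scale_fract (inverse a) (scale_fract a u) = u"
    "scale_fract a (scale_fract (inverse a) u) = u" for u
    using a_nonzero by (simp_all add: scale_scale scale_fract_scale_fract)
  note s = this
  have m: "scale x (- p) = - scale x p" for x and p :: "'a poly"
    using scale_diff[of x 0 p] by simp
  have bb: "[:inverse lam:] * [:lam:] = 1" "[:lam:] * [:inverse lam:] = 1"
    using b by (simp_all flip: one_pCons)
  have e1: "scale a c' + [:inverse lam:] * c = 0" "scale (inverse a) c + [:lam:] * c' = 0"
    using b by (simp_all add: c'_def m scale_smult s)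
  show ?thesis
    unfolding Aut_B_def alg_B_def aut_B_def
    by (rule ore_hom_aut[OF ore_hom_B inv.ore_hom_B[of c']])
      (use a_nonzero bb e1 in \<open>simp_all add: s scale_fract_to_fract to_fract_in_R_S b
         del: mult_pCons_left mult_pCons_right flip: to_fract_mult to_fract_add\<close>)
qed

lemma aut_B_A_to_B: "aut_B c (A_to_B f) = A_to_B (aut_A c f)"
proof (induction f rule: alg_A_induct[where h = h])
  case t
  show ?case
    by (simp add: A_to_B_pCons A_to_B_t aut_B_rules aut_A_rules)
qed (use a_nonzero in \<open>simp_all add: aut_B_rules aut_A_rules gen_x_def A_to_B_const
       scale_fract_to_fract A_to_B_add A_to_B_mult[OF h_nonzero]\<close>)

end

section \<open>Identifying sigma, tau and the extension to B\<close>

lemma Aut_A_eqI: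
  assumes "\<phi> \<in> Aut_A h" "\<phi>' \<in> Aut_A h" "\<phi> gen_x = \<phi>' gen_x" "\<phi> gen_t = \<phi>' gen_t"
  shows "\<phi> = \<phi>'"
proof
  fix f show "\<phi> f = \<phi>' f"
    by (rule alg_A_induct[of "\<lambda>f. \<phi> f = \<phi>' f" h])
      (use assms in \<open>auto simp: Aut_A_def alg_Aut_def ring_hom_def\<close>)
qed

context h_symmetry
begin

lemma aut_A_gen_x: "aut_A c gen_x = smult [:a:] gen_x"
  by (simp add: aut_A_rules gen_x_def scale_x)

lemma aut_A_0 [simp]: "aut_A c 0 = 0"
  using aut_A_rules(3)[of c 0] by simp

lemma tau_eq: "tau h a = aut_A 0"
proof -
  have t: "aut_A 0 gen_t = smult [:lam:] gen_t"
    by (simp add: aut_A_rules) (simp add: gen_t_def)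
  show ?thesis
    unfolding tau_def lam_def[symmetric]
    by (rule the_equality) (use t aut_A_gen_x aut_A_in_Aut in \<open>auto intro: Aut_A_eqI\<close>)
qed

end

text \<open>This is the trivial symmetry a = 1, for which \<open>lam\<close> is 1.\<close>

lemma sigma_eq:
  assumes "degree h > 0"
  shows "sigma h r = h_symmetry.aut_A h 1 r"
proof -
  interpret id: h_symmetry h 1
    by unfold_locales (use assms in auto)
  have x: "id.aut_A r gen_x = gen_x"
    by (simp add: id.aut_A_gen_x flip: one_pCons)
  have t: "id.aut_A r gen_t = gen_t + [:r:]"
    by (simp add: id.aut_A_rules id.lam_def) (simp add: gen_t_def one_pCons)
  show ?thesis
    unfolding sigma_def
    by (rule the_equality) (use x t id.aut_A_in_Aut in \<open>auto intro: Aut_A_eqI\<close>)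
qed

context h_symmetry
begin

text \<open>The inner map takes t to lam t and the outer one then to lam t + lam r, whence the
  factor on \<open>r\<close>.\<close>

lemma sigma_tau_eq: "sigma h r \<circ> tau h a = aut_A (smult lam r)"
proof
  fix f
  interpret id: h_symmetry h 1
    by unfold_locales (use h_nonconst in auto)
  interpret A: ore_data UNIV "\<lambda>p. h * pderiv p" by (rule ore_data_A)
  have "id.aut_A r (aut_A 0 f) = aut_A (smult lam r) f"
  proof (induction f rule: alg_A_induct[where h = h])
    case t
    have "aut_A 0 gen_t = MA h [:[:lam:]:] gen_t"
      by (simp add: aut_A_rules A.M_const) (simp add: gen_t_def)
    then show ?case
      by (simp only: id.aut_A_rules aut_A_rules(4)) (simp add: A.M_const id.lam_def)
  qed (simp_all add: aut_A_rules id.aut_A_rules gen_x_def)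
  then show "(sigma h r \<circ> tau h a) f = aut_A (smult lam r) f"
    by (simp add: sigma_eq h_nonconst tau_eq)
qed

text \<open>An extension is prescribed on A_h, and inverses must go to inverses, which fixes it on
  the powers of 1/psi. These and A_h generate B; outside the carrier extensionality decides.\<close>

lemma extend_B_eq: "extend_B h (aut_A c) = restrict (aut_B c) (carrier (alg_B h))"
  unfolding extend_B_def
proof (rule the_equality)
  interpret B: ore_data "R_S h" "d_S h" by (rule ore_data_B[OF h_nonzero])
  show "restrict (aut_B c) (carrier (alg_B h)) \<in> Aut_B h \<and>
    (\<forall>f. restrict (aut_B c) (carrier (alg_B h)) (A_to_B f) = A_to_B (aut_A c f))"
    using aut_B_in_Aut[of c] by (auto simp: carrier_alg_B A_to_B_closed aut_B_A_to_B)
  fix \<phi> assume \<phi>: "\<phi> \<in> Aut_B h \<and> (\<forall>f. \<phi> (A_to_B f) = A_to_B (aut_A c f))"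
  then have A: "\<phi> (A_to_B f) = A_to_B (aut_A c f)" for f by blast
  have add: "\<phi> (f + g) = \<phi> f + \<phi> g" and mult: "\<phi> (B.M f g) = B.M (\<phi> f) (\<phi> g)"
    if "\<forall>i. coeff f i \<in> R_S h" "\<forall>i. coeff g i \<in> R_S h" for f g
    using \<phi> that by (auto simp: Aut_B_def alg_Aut_def ring_hom_def carrier_alg_B alg_B_def)
  have ext: "\<phi> \<in> extensional (carrier (alg_B h))"
    using \<phi> by (auto simp: Aut_B_def alg_Aut_def Bij_def)
  have const_closed: "\<forall>i. coeff [:u:] i \<in> R_S h" if "u \<in> R_S h" for u
    using that by (auto simp: coeff_pCons split: nat.split)
  have A_const: "\<phi> [:to_fract p:] = [:to_fract (scale a p):]" for p
    using A[of "[:p:]"] by (simp add: A_to_B_const aut_A_rules)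
  have Pn: "to_fract (psi h) ^ n = to_fract (psi h ^ n)" for n
    by (induction n) simp_all
  have inv: "\<phi> [:inverse (to_fract (psi h ^ n)):] = [:inverse (to_fract (scale a (psi h ^ n))):]" for n
  proof -
    define v where "v = inverse (to_fract (psi h ^ n))"
    define q where "q = to_fract (scale a (psi h ^ n))"
    have nz: "psi h ^ n \<noteq> 0" "q \<noteq> 0"
      using psi_nonzero[OF h_nonzero] a_nonzero by (simp_all add: q_def)
    have v: "v \<in> R_S h"
      by (rule R_S_I[of _ 1 h n]) (simp add: v_def Pn inverse_eq_divide)
    have "B.M [:v:] [:to_fract (psi h ^ n):] = [:to_fract 1:]"
      using nz by (simp add: B.M_const v_def)
    \<comment> \<open>Applying \<open>\<phi>\<close> to v psi^n = 1 gives a left inverse of the unit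
      \<open>[:q:]\<close>; cancelling on the right determines \<open>\<phi> [:v:]\<close>.\<close>
    then have "B.M (\<phi> [:v:]) [:q:] = 1"
      using mult[OF const_closed[OF v] const_closed[OF to_fract_in_R_S[of "psi h ^ n" h]]] A_const[of 1]
      by (simp add: A_const q_def flip: one_pCons)
    then have "B.M (B.M (\<phi> [:v:]) [:q:]) [:inverse q:] = [:inverse q:]"
      by (simp add: B.M_1_left)
    then have "\<phi> [:v:] = [:inverse q:]"
      using nz(2) by (simp add: B.M_assoc B.M_const B.M_1_right flip: one_pCons)
    then show ?thesis by (simp add: v_def q_def)
  qed
  have eq: "\<phi> F = aut_B c F" if "\<forall>i. coeff F i \<in> R_S h" for F
    using that
  proof (induction rule: B.ore_induct)
    case (const u)
    then obtain p n where u: "u = to_fract p / to_fract (psi h ^ n)"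
      by (auto simp: R_S_def Pn)
    have v: "inverse (to_fract (psi h ^ n)) \<in> R_S h"
      by (rule R_S_I[of _ 1 h n]) (simp add: Pn inverse_eq_divide)
    have "[:u:] = B.M [:to_fract p:] [:inverse (to_fract (psi h ^ n)):]"
      by (simp add: B.M_const u divide_inverse)
    then have "\<phi> [:u:] = B.M [:to_fract (scale a p):] [:inverse (to_fract (scale a (psi h ^ n))):]"
      using mult[OF const_closed[OF to_fract_in_R_S] const_closed[OF v]]
      by (simp only: A_const inv)
    also have "\<dots> = [:scale_fract a u:]"
      using psi_nonzero[OF h_nonzero] a_nonzero
      by (simp add: B.M_const u scale_fract_div divide_inverse[symmetric])
    finally show ?case by (simp add: aut_B_rules)
  next
    case t
    show ?case
      using A[of gen_t] aut_B_A_to_B[of c gen_t] by (simp add: A_to_B_t)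
  qed (simp_all add: add mult aut_B_rules)
  show "\<phi> = restrict (aut_B c) (carrier (alg_B h))"
    by (rule extensionalityI[OF ext restrict_extensional]) (simp add: eq carrier_alg_B)
qed

section \<open>The criterion for commuting with D\<close>

lemma aut_B_closed: "\<forall>i. coeff f i \<in> R_S h \<Longrightarrow> \<forall>i. coeff (aut_B c f) i \<in> R_S h"
  unfolding aut_B_def by (rule ore_hom.\<Phi>_closed[OF ore_hom_B])

text \<open>Conjugation by an automorphism turns \<open>ad w + \<Delta>\<close> into \<open>ad (\<rho> w) + \<rho> \<Delta> \<rho>\<^sup>-\<^sup>1\<close>.\<close>

lemma commutes_iff:
  assumes D: "\<And>f. A_to_B (D f) = ad_B h w (A_to_B f) + A_to_B (Delta h s f)"
  shows "aut_A c \<circ> D = D \<circ> aut_A c \<longleftrightarrow>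
    (\<forall>f. ad_B h (aut_B c w - w) (A_to_B (aut_A c f)) =
       A_to_B (Delta h s (aut_A c f) - aut_A c (Delta h s f)))"
proof -
  interpret B: ore_data "R_S h" "d_S h" by (rule ore_data_B[OF h_nonzero])
  have minus: "aut_B c (f - g) = aut_B c f - aut_B c g" for f g
    using aut_B_rules(1)[of c "f - g" g] by (simp add: algebra_simps)
  have 1: "A_to_B (aut_A c (D f)) = ad_B h (aut_B c w) (A_to_B (aut_A c f)) + A_to_B (aut_A c (Delta h s f))" for f
    by (simp add: D ad_B_def aut_B_rules minus flip: aut_B_A_to_B)
  have 2: "ad_B h (aut_B c w - w) g = ad_B h (aut_B c w) g - ad_B h w g" for g
    by (simp add: ad_B_def B.M_diff_left B.M_diff_right)
  \<comment> \<open>Injectivity of \<open>A_to_B\<close> allows the comparison to be made in B,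
    where both sides are commutators plus a correction.\<close>
  have "aut_A c \<circ> D = D \<circ> aut_A c \<longleftrightarrow> (\<forall>f. A_to_B (aut_A c (D f)) = A_to_B (D (aut_A c f)))"
    by (simp add: fun_eq_iff)
  then show ?thesis
    by (simp add: 1 2 D A_to_B_diff algebra_simps)
qed

lemma commutes_iff_on_generators:
  assumes char: "\<And>n. of_nat (Suc n) \<noteq> (0::'a)"
  shows "(\<forall>f. ad_B h z (A_to_B (aut_A c f)) =
       A_to_B (Delta h s (aut_A c f) - aut_A c (Delta h s f))) \<longleftrightarrow>
    (\<exists>u. z = [:u:] \<and> d_S h u = to_fract (smult (inverse lam) (scale a s) - s))"
    (is "(\<forall>f. ?F f = ?G f) \<longleftrightarrow> ?R")
proof -
  interpret A: ore_data UNIV "\<lambda>p. h * pderiv p" by (rule ore_data_A)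
  interpret B: ore_data "R_S h" "d_S h" by (rule ore_data_B[OF h_nonzero])
  have Der: "Delta h s (f + g) = Delta h s f + Delta h s g"
    "Delta h s (A.M f g) = A.M (Delta h s f) g + A.M f (Delta h s g)" for f g
    using Delta_in_Der[of h s] by (auto simp: Der_A_def)
  have at_x: "?F gen_x = ad_B h z [:to_fract [:0, a:]:]" "?G gen_x = 0"
    by (simp_all add: gen_x_def aut_A_rules scale_x A_to_B_const Delta_const)
  have "[:c, [:lam:]:] = [:c:] + A.M [:[:lam:]:] gen_t"
    by (simp add: A.M_const gen_t_def)
  then have at_t: "?G gen_t = A_to_B [:smult lam s - scale a s:]"
    by (simp only: aut_A_rules Der Delta_const Delta_t) (simp add: A.M_const)
  have at_t': "ad_B h [:u:] (A_to_B (aut_A c gen_t)) = [:- (to_fract [:lam:] * d_S h u):]" for u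
    by (simp add: aut_A_rules A_to_B_pCons ad_B_def B.M_const B.M_pCons B.L_const mult.commute)
  \<comment> \<open>Since [u, c + lam t] = - lam d_S(u), the condition at t is divided by - lam to
    solve for d_S(u).\<close>
  have lam_sol: "- (to_fract [:lam:] * v) = to_fract (smult lam s - scale a s) \<longleftrightarrow>
      v = to_fract (smult (inverse lam) (scale a s) - s)" for v
  proof -
    have "smult lam s - scale a s = - ([:lam:] * (smult (inverse lam) (scale a s) - s))"
      using lam_nonzero by (simp add: smult_diff_right)
    then have "to_fract (smult lam s - scale a s) =
        - (to_fract [:lam:] * to_fract (smult (inverse lam) (scale a s) - s))"
      by (simp only: to_fract_uminus to_fract_mult)
    moreover have "to_fract [:lam:] \<noteq> 0" using lam_nonzero by simp
    ultimately show ?thesis by simp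
  qed
  show ?thesis
  proof
    assume *: "\<forall>f. ?F f = ?G f"
    \<comment> \<open>By \<open>at_x\<close>, z commutes with a x, and d_S(a x) = a h is nonzero;
      \<open>char\<close> takes care of the integer factor.\<close>
    have nz: "of_nat (Suc n) * d_S h (to_fract [:0, a:]) * b \<noteq> 0" if "b \<noteq> 0" for n b
    proof -
      have of_nat: "of_nat m = to_fract [:of_nat m :: 'a:]" for m
      proof (induction m)
        case (Suc m)
        have "to_fract [:of_nat (Suc m):] = to_fract (1 + [:of_nat m :: 'a:])"
          by (simp add: one_pCons)
        then show ?case by (simp only: to_fract_add to_fract_1 of_nat_Suc Suc)
      qed simp
      show ?thesis
        using that char[of n] a_nonzero h_nonzero
        by (simp add: of_nat d_S_to_fract pderiv_pCons del: of_nat_Suc)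
    qed
    have "ad_B h z [:to_fract [:0, a:]:] = 0"
      using * at_x by metis
    then have "B.M z [:to_fract [:0, a:]:] = smult (to_fract [:0, a:]) z"
      by (simp add: ad_B_def B.M_const)
    then have "degree z = 0"
      by (rule B.commute_const_imp_degree_0) (rule nz)
    then obtain u where u: "z = [:u:]" by (auto elim: degree_eq_zeroE)
    have "?F gen_t = ?G gen_t" using * by blast
    then show ?R
      using u at_t at_t'[of u] lam_sol[of "d_S h u"] by (simp add: A_to_B_const)
  next
    assume ?R
    then obtain u where z: "z = [:u:]" and u: "d_S h u = to_fract (smult (inverse lam) (scale a s) - s)"
      by blast
    show "\<forall>f. ?F f = ?G f"
    proof
      fix f show "?F f = ?G f"
      proof (induction f rule: alg_A_induct[where h = h])
        case (const b)
        show ?case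
          by (simp add: aut_A_rules Delta_const A_to_B_const ad_B_def z B.M_const mult.commute)
      next
        case x
        show ?case
          unfolding at_x by (simp add: ad_B_def z B.M_const mult.commute)
      next
        case t
        show ?case
          using at_t at_t'[of u] lam_sol[of "d_S h u"] u z by (simp add: A_to_B_const)
      next
        case (add f g)
        have "?F (f + g) = ?F f + ?F g"
          by (simp add: aut_A_rules A_to_B_add ad_B_def B.M_add_left B.M_add_right)
        also have "\<dots> = ?G (f + g)"
          by (simp add: add aut_A_rules A_to_B_add A_to_B_diff Der)
        finally show ?case .
      next
        case (mult f g)
        \<comment> \<open>Both sides obey the Leibniz rule twisted by \<open>aut_A c\<close>, so
          agreement passes to products.\<close>
        have "?F (A.M f g) = B.M (?F f) (A_to_B (aut_A c g)) + B.M (A_to_B (aut_A c f)) (?F g)"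
          by (simp add: aut_A_rules A_to_B_mult[OF h_nonzero] ad_B_def B.M_diff_left B.M_diff_right
              B.M_assoc)
        also have "\<dots> = ?G (A.M f g)"
          by (simp add: mult aut_A_rules A_to_B_mult[OF h_nonzero] A_to_B_add A_to_B_diff Der
              B.M_diff_left B.M_diff_right)
        finally show ?case .
      qed
    qed
  qed
qed

end

theorem proposition41:
  fixes h s r :: "'a::{alg_closed_field, field_char_0, field_gcd} poly"
    and w H :: "'a poly poly" and a :: 'a and N :: nat
  defines "wstar \<equiv> A_to_B w + psi_inv_mult h H"
    and "D \<equiv> (\<lambda>f. ad_A h w f + E_der h H f + Delta h s f)"
    and "\<rho> \<equiv> sigma h r \<circ> tau h a"
  assumes "lead_coeff h = 1" and "degree h = N" and "N \<ge> 2" and "coeff h (N - 1) = 0"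
    and "psi h \<noteq> 1"
    and "special h H"
    and "degree s < degree h"
    and "a \<noteq> 0" and "pcompose h [:0, a:] = smult (a ^ N) h"
  shows "\<rho> \<in> Aut_commuting h D \<longleftrightarrow>
    (\<exists>u\<in>R_S h. extend_B h \<rho> wstar - wstar = [:u:] \<and>
       d_S h u = to_fract (smult (a powi (1 - int N)) (pcompose s [:0, a:]) - s))"
proof -
  interpret h_symmetry h a
    by unfold_locales (use assms in \<open>auto simp: scale_def\<close>)
  interpret B: ore_data "R_S h" "d_S h" by (rule ore_data_B[OF h_nonzero])
  define c where "c = smult lam r"
  have \<rho>: "\<rho> = aut_A c"
    by (simp add: \<rho>_def sigma_tau_eq c_def)
  have D: "A_to_B (D f) = ad_B h wstar (A_to_B f) + A_to_B (Delta h s f)" for f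
    by (simp add: D_def wstar_def A_to_B_add A_to_B_E_der[OF h_nonzero] ad_A_def ad_B_def
        A_to_B_diff A_to_B_mult[OF h_nonzero] B.M_add_left B.M_add_right)
  have "inverse (to_fract (psi h)) \<in> R_S h"
    by (rule R_S_I[of _ 1 h 1]) (simp add: inverse_eq_divide)
  then have wstar: "\<forall>i. coeff wstar i \<in> R_S h"
    by (simp add: wstar_def psi_inv_mult_eq[OF h_nonzero] A_to_B_closed B.C_add B.C_mult)
  then have ext: "extend_B h \<rho> wstar = aut_B c wstar"
    by (simp add: \<rho> extend_B_eq carrier_alg_B)
  \<comment> \<open>The criterion on generators only provides \<open>u\<close> in the field of
    fractions; membership in \<open>R_S h\<close> comes from the coefficients of
    \<open>wstar\<close> and of its image.\<close>
  have "\<forall>i. coeff (aut_B c wstar - wstar) i \<in> R_S h"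
    using aut_B_closed[OF wstar] wstar by (simp add: B.C_diff)
  then have R_S: "u \<in> R_S h" if "aut_B c wstar - wstar = [:u:]" for u
    using that by (metis coeff_pCons_0)
  \<comment> \<open>The exponent is negative because N is at least 2, so the integer power is the
    inverse of a^(N-1).\<close>
  have "a powi (1 - int N) = inverse lam"
    using \<open>N \<ge> 2\<close> \<open>degree h = N\<close>
    by (simp add: lam_def power_int_def nat_diff_distrib power_inverse)
  then have "smult (a powi (1 - int N)) (pcompose s [:0, a:]) - s = smult (inverse lam) (scale a s) - s"
    by (simp add: scale_def)
  moreover have "\<rho> \<in> Aut_commuting h D \<longleftrightarrow> aut_A c \<circ> D = D \<circ> aut_A c"
    by (simp add: Aut_commuting_def \<rho> aut_A_in_Aut)
  moreover have "\<dots> \<longleftrightarrow> (\<exists>u. aut_B c wstar - wstar = [:u:] \<and>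
      d_S h u = to_fract (smult (inverse lam) (scale a s) - s))"
    unfolding commutes_iff[OF D]
    by (rule commutes_iff_on_generators) (simp del: of_nat_Suc)
  ultimately show ?thesis
    using R_S by (auto simp: ext)
qed

end
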